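(* There is an absolute constant $c_0>0$ such that the following holds. Let $2^{-c_0n}<\varepsilon<\tfrac13$ and $2^{-n}<\delta<\tfrac12$, and let $f(x,y)=(-1)^{\langle x,y\rangle}$ on $\{0,1\}^n\times\{0,1\}^n$. Any one-way public-coin protocol (Alice sends a single message, Bob outputs) that, on every pair of inputs $(p,q)$ with $p$ a probability distribution on $\{0,1\}^n$ held by Alice and $q$ a probability distribution on $\{0,1\}^n$ held by Bob, outputs an estimate of $\mathbb{E}_{x\sim p,y\sim q}[f(x,y)]$ within additive error $\varepsilon$ with success probability at least $1-\delta$, must send a message of length \[\Omega\!\left(\frac{n\log_2\!\big(1/(4\delta(1-\delta))\big)}{\varepsilon^2}\right).\]
   Context: $\langle x,y\rangle$ denotes the inner product over $\mathbb{F}_2$. $\Omega$ hides an absolute constant. *)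

theory Defs
  imports "HOL-Probability.Probability" "HOL-Library.Z2"
begin

definition cube :: "nat \<Rightarrow> bit list set" where
  "cube n = {x. length x = n}"

definition cube_pmfs :: "nat \<Rightarrow> bit list pmf set" where
  "cube_pmfs n = {p. set_pmf p \<subseteq> cube n}"

definition inner_F2 :: "nat \<Rightarrow> bit list \<Rightarrow> bit list \<Rightarrow> bit" where
  "inner_F2 n x y = (\<Sum>i<n. x ! i * y ! i)"

definition ip_sign :: "nat \<Rightarrow> bit list \<Rightarrow> bit list \<Rightarrow> real" where
  "ip_sign n x y = (if inner_F2 n x y = 0 then 1 else - 1)"

definition bilinear_mean ::
  "(bit list \<Rightarrow> bit list \<Rightarrow> real) \<Rightarrow> bit list pmf \<Rightarrow> bit list pmf \<Rightarrow> real" where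
  "bilinear_mean f p q = measure_pmf.expectation (pair_pmf p q) (\<lambda>(x, y). f x y)"

text \<open>
  The public randomness is an infinite bit string with an arbitrary law (on an arbitrary
  sigma-algebra). It is a fixed type rather than a type variable because constants that are
  existentially quantified inside a theorem could otherwise depend on that type.
\<close>

type_synonym coins = "nat \<Rightarrow> bool"
type_synonym message = "bool list"
type_synonym alice = "coins \<Rightarrow> bit list pmf \<Rightarrow> message"
type_synonym bob = "coins \<Rightarrow> message \<Rightarrow> bit list pmf \<Rightarrow> real"

definition one_way_estimates ::
  "nat \<Rightarrow> (bit list \<Rightarrow> bit list \<Rightarrow> real) \<Rightarrow> real \<Rightarrow> real \<Rightarrow>
   coins measure \<Rightarrow> alice \<Rightarrow> bob \<Rightarrow> bool" where
  "one_way_estimates n f \<epsilon> \<delta> M A B \<longleftrightarrow>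
     prob_space M \<and>
     (\<forall>p\<in>cube_pmfs n. \<forall>q\<in>cube_pmfs n.
        let good = {r \<in> space M. \<bar>B r (A r p) q - bilinear_mean f p q\<bar> \<le> \<epsilon>}
        in good \<in> sets M \<and> measure M good \<ge> 1 - \<delta>)"

text \<open>
  Worst-case length over Alice's inputs and the coins. Messages may have different lengths and
  need not form a prefix-free code.
\<close>

definition message_length_le :: "nat \<Rightarrow> coins measure \<Rightarrow> alice \<Rightarrow> nat \<Rightarrow> bool" where
  "message_length_le n M A C \<longleftrightarrow>
     (\<forall>r\<in>space M. \<forall>p\<in>cube_pmfs n. length (A r p) \<le> C)"

end

theory Submission imports Defs begin

text \<open>
  Alice holds the uniform distribution on a random tuple \<open>S\<close> of \<open>k\<close> points and Bob a point mass at
  \<open>y\<close>, so that the target is the average of \<open>k\<close> signs. Tilting \<open>y\<close> by the Riesz product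
  \<open>tilt \<rho> k S\<close> shifts this average from 0 to about \<open>\<rho>\<close>. Hence the set \<open>\<Phi>\<close> of those \<open>y\<close> for which the
  message announces a value near \<open>\<rho>\<close> has large tilted mass, although it has tiny uniform measure \<open>\<tau>\<close>:
  for small \<open>\<delta>\<close> because large averages are exponentially rare, and for \<open>\<delta>\<close> close to 1/2 because the
  sets that belong to many well separated values of \<open>\<rho>\<close> are disjoint.

  To count the tuples \<open>S\<close> that can share one set \<open>\<Phi>\<close>, draw \<open>t\<close> of order \<open>n / \<rho>\<^sup>2\<close> independent
  points \<open>T\<close> from the tilted law restricted to \<open>\<Phi>\<close>. The likelihood of the pair \<open>(S, T)\<close> is the
  product of all \<open>1 + \<rho> * \<xi> (S i) (T s)\<close>, so it can be averaged over \<open>S\<close> for fixed \<open>T\<close>: this average is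
  \<open>exp (O (t))\<close> for typical pairs, while \<open>T\<close> ranges over a set of measure \<open>\<tau> ^ t\<close>. So one message serves a
  fraction of at most \<open>(exp 24 * \<tau>) ^ t\<close> of all tuples, up to lower order factors. If both \<open>\<epsilon>\<close> and \<open>\<delta>\<close>
  are bounded away from 0, the discrepancy bound for the inner product function suffices.
\<close>

section \<open>Averages over finite sets and tuples\<close>

text \<open>The three factors of the bound have separate sources. Each sampled point contributes
  \<open>ln (1 / \<tau>)\<close>, which is of order \<open>ln (1 / \<delta>)\<close> for small
  \<open>\<delta>\<close>, and there are \<open>t\<close> of them, of order
  \<open>n / \<epsilon>\<^sup>2\<close>. What limits \<open>t\<close> is the spectrum of the
  restricted law: up to polynomial factors in \<open>t\<close> and \<open>k\<close>,
  \<open>(1 + \<rho>\<^sup>2) ^ k * exp (2 * \<rho>\<^sup>2 * t)\<close> must stay below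
  \<open>2 ^ n\<close>. The lower bound on \<open>\<epsilon>\<close> keeps these polynomial factors
  harmless.

  The obstacle is that the message chooses \<open>\<Phi>\<close>, so a few \<open>x\<close> may
  correlate strongly with \<open>T\<close> and dominate the average likelihood. The likelihood is
  therefore truncated. The truncation is paid for by the deviations of the signs of the true
  \<open>S i\<close>, and these add up to only O(\<open>t\<^sup>2\<close>), because the tilted law
  of a typical \<open>S\<close> makes the signs nearly uncorrelated.

  The loss of \<open>exp 24\<close> per point requires \<open>\<tau>\<close> below
  \<open>exp (- 24)\<close>. This dictates the thresholds \<open>10 ^ 6\<close> for
  \<open>ln (1 / \<delta>)\<close> and \<open>50 * exp 30\<close> for the number of levels. In the
  remaining range only a bound of order \<open>n * (1 - 2 * \<delta>)\<^sup>2\<close> has to be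
  shown.\<close>

definition mean :: "'a set \<Rightarrow> ('a \<Rightarrow> real) \<Rightarrow> real" where
  "mean A f = (\<Sum>x\<in>A. f x) / real (card A)"

lemma mean_cong: "(\<And>x. x \<in> A \<Longrightarrow> f x = g x) \<Longrightarrow> mean A f = mean A g"
  by (simp add: mean_def)

lemma mean_mono: "(\<And>x. x \<in> A \<Longrightarrow> f x \<le> g x) \<Longrightarrow> mean A f \<le> mean A g"
  by (simp add: mean_def divide_right_mono sum_mono)

lemma mean_nonneg: "(\<And>x. x \<in> A \<Longrightarrow> 0 \<le> f x) \<Longrightarrow> 0 \<le> mean A f"
  by (simp add: mean_def sum_nonneg)

lemma mean_add: "mean A (\<lambda>x. f x + g x) = mean A f + mean A g"
  by (simp add: mean_def sum.distrib add_divide_distrib)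

lemma mean_diff: "mean A (\<lambda>x. f x - g x) = mean A f - mean A g"
  by (simp add: mean_def sum_subtractf diff_divide_distrib)

lemma mean_cmult: "mean A (\<lambda>x. c * f x) = c * mean A f"
  by (simp add: mean_def sum_distrib_left)

lemma mean_sum: "mean A (\<lambda>x. \<Sum>i\<in>I. f i x) = (\<Sum>i\<in>I. mean A (f i))"
  unfolding mean_def by (subst sum.swap) (simp add: sum_divide_distrib)

lemma mean_const: "finite A \<Longrightarrow> A \<noteq> {} \<Longrightarrow> mean A (\<lambda>x. c) = c"
  by (simp add: mean_def)

lemma mean_swap: "mean A (\<lambda>x. mean B (f x)) = mean B (\<lambda>y. mean A (\<lambda>x. f x y))"
  unfolding mean_def by (subst sum_divide_distrib[symmetric], subst sum.swap)
    (simp add: sum_divide_distrib mult.commute)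

lemma mean_markov:
  assumes "\<And>x. x \<in> A \<Longrightarrow> 0 \<le> f x" "0 < c"
  shows "mean A (\<lambda>x. of_bool (c < f x)) \<le> mean A f / c"
proof -
  have "mean A (\<lambda>x. of_bool (c < f x)) \<le> mean A (\<lambda>x. (1 / c) * f x)"
    using assms by (intro mean_mono) (auto simp: of_bool_def)
  then show ?thesis by (simp only: mean_cmult) simp
qed

lemma sum_markov:
  fixes w f :: "'a \<Rightarrow> real"
  assumes "\<And>x. x \<in> A \<Longrightarrow> 0 \<le> w x" "\<And>x. x \<in> A \<Longrightarrow> 0 \<le> f x" "0 < c"
  shows "(\<Sum>x\<in>A. w x * of_bool (c < f x)) \<le> (\<Sum>x\<in>A. w x * f x) / c"
proof -
  have "(\<Sum>x\<in>A. w x * of_bool (c < f x)) \<le> (\<Sum>x\<in>A. w x * (f x / c))"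
    using assms by (intro sum_mono mult_left_mono) (auto simp: of_bool_def)
  then show ?thesis by (simp add: sum_divide_distrib)
qed

lemma mean_Times:
  "mean A (\<lambda>x. mean B (f x)) = (\<Sum>(x, y)\<in>A \<times> B. f x y) / (real (card A) * real (card B))"
  by (simp add: mean_def sum.cartesian_product[symmetric] sum_divide_distrib[symmetric])

lemma mean_of_bool_mem:
  assumes "finite A" "B \<subseteq> A"
  shows "mean A (\<lambda>x. of_bool (x \<in> B)) = real (card B) / real (card A)"
proof -
  have "(\<Sum>x\<in>A. of_bool (x \<in> B)) = (\<Sum>x\<in>B. 1 :: real)"
    using assms by (intro sum.mono_neutral_cong_right) auto
  then show ?thesis by (simp add: mean_def)
qed

lemma mean_singleton: "mean {y} f = f y"
  by (simp add: mean_def)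

abbreviation tuples :: "nat \<Rightarrow> 'a set \<Rightarrow> (nat \<Rightarrow> 'a) set" where
  "tuples k A \<equiv> {..<k} \<rightarrow>\<^sub>E A"

lemma finite_tuples: "finite A \<Longrightarrow> finite (tuples k A)"
  by (simp add: finite_PiE)

lemma card_tuples: "finite A \<Longrightarrow> card (tuples k A) = card A ^ k"
  by (simp add: card_PiE)

lemma tuples_nonempty: "A \<noteq> {} \<Longrightarrow> tuples k A \<noteq> {}"
  by (simp add: PiE_eq_empty_iff)

lemma sum_tuples_prod:
  fixes q :: "'a \<Rightarrow> real"
  assumes "finite A"
  shows "(\<Sum>F\<in>tuples k A. \<Prod>i<k. q (F i)) = (\<Sum>x\<in>A. q x) ^ k"
  using prod_sum_PiE[of "{..<k}" "\<lambda>_. A" "\<lambda>_. q"] assms by simp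

lemma mean_tuples_prod:
  assumes "finite A"
  shows "mean (tuples k A) (\<lambda>F. \<Prod>i<k. q (F i)) = mean A q ^ k"
  using assms by (simp add: mean_def sum_tuples_prod card_tuples power_divide)

lemma sum_tuples_prod_at:
  fixes q f :: "'a \<Rightarrow> real"
  assumes "finite A" "i < k"
  shows "(\<Sum>F\<in>tuples k A. (\<Prod>l<k. q (F l)) * f (F i)) =
         (\<Sum>x\<in>A. q x) ^ (k - 1) * (\<Sum>x\<in>A. q x * f x)"
proof -
  define h where "h l x = (if l = i then q x * f x else q x)" for l x
  have "(\<Prod>l<k. q (F l)) * f (F i) = (\<Prod>l<k. h l (F l))" for F
  proof -
    have "(\<Prod>l\<in>{..<k} - {i}. h l (F l)) = (\<Prod>l\<in>{..<k} - {i}. q (F l))"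
      by (rule prod.cong) (auto simp: h_def)
    then show ?thesis using assms(2)
      by (simp add: prod.remove[of "{..<k}" i] h_def mult_ac)
  qed
  then have "(\<Sum>F\<in>tuples k A. (\<Prod>l<k. q (F l)) * f (F i)) = (\<Prod>l<k. \<Sum>x\<in>A. h l x)"
    using assms(1) by (simp add: prod_sum_PiE)
  also have "\<dots> = (\<Sum>x\<in>A. h i x) * (\<Prod>l\<in>{..<k} - {i}. \<Sum>x\<in>A. h l x)"
    using assms(2) by (simp add: prod.remove[of "{..<k}" i])
  also have "(\<Prod>l\<in>{..<k} - {i}. \<Sum>x\<in>A. h l x) = (\<Prod>l\<in>{..<k} - {i}. \<Sum>x\<in>A. q x)"
    by (rule prod.cong) (auto simp: h_def)
  finally show ?thesis using assms(2) by (simp add: h_def)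
qed

lemma sum_tuples_prod_at2:
  fixes q f g :: "'a \<Rightarrow> real"
  assumes "finite A" "i < k" "j < k" "i \<noteq> j"
  shows "(\<Sum>F\<in>tuples k A. (\<Prod>l<k. q (F l)) * (f (F i) * g (F j))) =
         (\<Sum>x\<in>A. q x) ^ (k - 2) * (\<Sum>x\<in>A. q x * f x) * (\<Sum>x\<in>A. q x * g x)"
proof -
  define h where "h l x = (if l = i then q x * f x else if l = j then q x * g x else q x)" for l x
  have rem: "(\<Prod>l<k. u l) = u i * (u j * (\<Prod>l\<in>{..<k} - {i} - {j}. u l))" for u :: "nat \<Rightarrow> real"
    using assms by (simp add: prod.remove[of "{..<k}" i] prod.remove[of "{..<k} - {i}" j])
  have "(\<Prod>l<k. q (F l)) * (f (F i) * g (F j)) = (\<Prod>l<k. h l (F l))" for F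
  proof -
    have "(\<Prod>l\<in>{..<k} - {i} - {j}. h l (F l)) = (\<Prod>l\<in>{..<k} - {i} - {j}. q (F l))"
      by (rule prod.cong) (auto simp: h_def)
    then show ?thesis using assms(4)
      by (simp add: rem h_def mult_ac)
  qed
  then have "(\<Sum>F\<in>tuples k A. (\<Prod>l<k. q (F l)) * (f (F i) * g (F j))) = (\<Prod>l<k. \<Sum>x\<in>A. h l x)"
    using assms(1) by (simp add: prod_sum_PiE)
  also have "\<dots> = (\<Sum>x\<in>A. h i x) * ((\<Sum>x\<in>A. h j x) * (\<Prod>l\<in>{..<k} - {i} - {j}. \<Sum>x\<in>A. h l x))"
    by (rule rem)
  also have "(\<Prod>l\<in>{..<k} - {i} - {j}. \<Sum>x\<in>A. h l x) = (\<Prod>l\<in>{..<k} - {i} - {j}. \<Sum>x\<in>A. q x)"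
    by (rule prod.cong) (auto simp: h_def)
  finally show ?thesis using assms by (simp add: h_def numeral_2_eq_2)
qed

text \<open>After expanding the square, a pair \<open>i = j\<close> gives a second moment and every
  other pair, by independence, a squared first moment. This is the variance computation both for
  samples of Bob's points and for tilted tuples of Alice's points.\<close>

lemma sum_tuples_second_moment:
  fixes q h :: "'a \<Rightarrow> real"
  assumes "finite A" "(\<Sum>x\<in>A. q x) = 1"
  shows "(\<Sum>F\<in>tuples k A. (\<Prod>l<k. q (F l)) * (\<Sum>i<k. h (F i))\<^sup>2) =
         real k * (\<Sum>x\<in>A. q x * (h x)\<^sup>2) + real k * (real k - 1) * (\<Sum>x\<in>A. q x * h x)\<^sup>2"
proof -
  define a b where "a = (\<Sum>x\<in>A. q x * (h x)\<^sup>2)" and "b = (\<Sum>x\<in>A. q x * h x)\<^sup>2"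
  have "(\<Sum>F\<in>tuples k A. (\<Prod>l<k. q (F l)) * (\<Sum>i<k. h (F i))\<^sup>2) =
        (\<Sum>F\<in>tuples k A. \<Sum>i<k. \<Sum>j<k. (\<Prod>l<k. q (F l)) * (h (F i) * h (F j)))"
    by (simp only: power2_eq_square sum_product) (simp only: sum_distrib_left)
  also have "\<dots> = (\<Sum>i<k. \<Sum>j<k. \<Sum>F\<in>tuples k A. (\<Prod>l<k. q (F l)) * (h (F i) * h (F j)))"
    by (subst sum.swap, rule sum.cong[OF refl], subst sum.swap, rule refl)
  also have "\<dots> = (\<Sum>i<k. \<Sum>j<k. if j = i then a else b)"
  proof (intro sum.cong refl)
    fix i j assume "i \<in> {..<k}" "j \<in> {..<k}"
    then show "(\<Sum>F\<in>tuples k A. (\<Prod>l<k. q (F l)) * (h (F i) * h (F j))) = (if j = i then a else b)"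
      using sum_tuples_prod_at[OF assms(1), of i k q "\<lambda>x. h x * h x"]
        sum_tuples_prod_at2[OF assms(1), of i k j q h h] assms(2)
      by (auto simp: a_def b_def power2_eq_square)
  qed
  also have "\<dots> = (\<Sum>i<k. a + (real k - 1) * b)"
    by (intro sum.cong refl) (simp add: sum.If_cases Int_Diff Diff_eq[symmetric] of_nat_diff)
  finally show ?thesis by (simp add: a_def b_def algebra_simps)
qed

lemma mean_mult_mean: "mean A f * mean B g = mean A (\<lambda>x. mean B (\<lambda>y. f x * g y))"
  unfolding mean_cmult mult.commute[of _ "mean B g"] by (rule refl)

text \<open>The diagonal is one part in \<open>card A\<close> of all pairs. Second moments of
  averages over \<open>Y\<close> expand into such double means, in which pairwise independence
  controls the off-diagonal terms.\<close>

lemma mean_mean_le_diagonal: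
  assumes "finite A" "A \<noteq> {}" "0 \<le> c"
    and off: "\<And>x y. x \<in> A \<Longrightarrow> y \<in> A \<Longrightarrow> x \<noteq> y \<Longrightarrow> f x y \<le> c"
    and diag: "\<And>x. x \<in> A \<Longrightarrow> f x x \<le> d"
  shows "mean A (\<lambda>x. mean A (f x)) \<le> c + \<bar>d\<bar> / real (card A)"
proof -
  have "mean A (f x) \<le> c + \<bar>d\<bar> / real (card A)" if "x \<in> A" for x
  proof -
    have "f x y \<le> c + (if y = x then \<bar>d\<bar> else 0)" if "y \<in> A" for y
      using off[of x y] diag[of x] \<open>x \<in> A\<close> that assms(3) by auto
    then have "mean A (f x) \<le> mean A (\<lambda>y. c + (if y = x then \<bar>d\<bar> else 0))"
      by (rule mean_mono)
    also have "\<dots> = c + \<bar>d\<bar> / real (card A)"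
      using assms(1,2) that by (simp add: mean_add mean_const) (simp add: mean_def)
    finally show ?thesis .
  qed
  then have "mean A (\<lambda>x. mean A (f x)) \<le> mean A (\<lambda>x. c + \<bar>d\<bar> / real (card A))"
    by (rule mean_mono)
  then show ?thesis using assms(1,2) by (simp add: mean_const)
qed

section \<open>Riesz products of pairwise independent signs\<close>

text \<open>Independence is required for averages over \<open>X\<close> only. In the application
  \<open>Y\<close> lacks the zero vector, so averages over \<open>y\<close> do not vanish.\<close>

locale sign_matrix =
  fixes X :: "'a set" and Y :: "'b set" and \<xi> :: "'a \<Rightarrow> 'b \<Rightarrow> real"
  assumes finite_X: "finite X" and X_ne: "X \<noteq> {}" and finite_Y: "finite Y" and Y_ne: "Y \<noteq> {}"
    and sign_square: "\<xi> x y * \<xi> x y = 1"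
    and mean_sign: "y \<in> Y \<Longrightarrow> mean X (\<lambda>x. \<xi> x y) = 0"
    and mean_sign_sign: "y \<in> Y \<Longrightarrow> y' \<in> Y \<Longrightarrow> y \<noteq> y' \<Longrightarrow> mean X (\<lambda>x. \<xi> x y * \<xi> x y') = 0"
begin

lemma abs_sign: "\<bar>\<xi> x y\<bar> = 1"
  using sign_square[of x y] by (metis abs_square_eq_1 power2_eq_square)

lemma sign_cases: "\<xi> x y = 1 \<or> \<xi> x y = -1"
  using abs_sign[of x y] by linarith

text \<open>For fixed \<open>y\<close> this is a probability density on uniform tuples, under which
  the \<open>S i\<close> are independent and \<open>\<xi> (S i) y\<close> has mean
  \<open>\<rho>\<close>. For fixed \<open>S\<close> it is the Bayes weight of \<open>y\<close>,
  normalised only approximately, and only for typical \<open>S\<close>.\<close>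

definition tilt :: "real \<Rightarrow> nat \<Rightarrow> (nat \<Rightarrow> 'a) \<Rightarrow> 'b \<Rightarrow> real" where
  "tilt \<rho> k S y = (\<Prod>i<k. 1 + \<rho> * \<xi> (S i) y)"

lemma tilt_factor_nonneg: "0 \<le> \<rho> \<Longrightarrow> \<rho> \<le> 1 \<Longrightarrow> 0 \<le> 1 + \<rho> * \<xi> x y"
  using sign_cases[of x y] by auto

lemma tilt_nonneg: "0 \<le> \<rho> \<Longrightarrow> \<rho> \<le> 1 \<Longrightarrow> 0 \<le> tilt \<rho> k S y"
  unfolding tilt_def by (intro prod_nonneg) (simp add: tilt_factor_nonneg)

lemma mean_tilt_factor:
  assumes "y \<in> Y"
  shows "mean X (\<lambda>x. 1 + \<rho> * \<xi> x y) = 1"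
  using assms finite_X X_ne by (simp add: mean_add mean_const mean_cmult mean_sign)

lemma mean_tilt:
  assumes "y \<in> Y"
  shows "mean (tuples k X) (\<lambda>S. tilt \<rho> k S y) = 1"
  unfolding tilt_def
  using mean_tuples_prod[OF finite_X, of k "\<lambda>x. 1 + \<rho> * \<xi> x y"] assms
  by (simp add: mean_tilt_factor)

lemma mean_tilt_tilt:
  assumes "y \<in> Y" "y' \<in> Y"
  shows "mean (tuples k X) (\<lambda>S. tilt \<rho> k S y * tilt \<rho> k S y') = (if y = y' then (1 + \<rho>\<^sup>2) ^ k else 1)"
proof -
  have "mean X (\<lambda>x. (1 + \<rho> * \<xi> x y) * (1 + \<rho> * \<xi> x y')) =
        mean X (\<lambda>x. 1 + (\<rho> * \<xi> x y + (\<rho> * \<xi> x y' + \<rho>\<^sup>2 * (\<xi> x y * \<xi> x y'))))"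
    by (simp add: algebra_simps power2_eq_square)
  also have "\<dots> = 1 + \<rho>\<^sup>2 * mean X (\<lambda>x. \<xi> x y * \<xi> x y')"
    using finite_X X_ne assms by (simp add: mean_add mean_const mean_cmult mean_sign)
  also have "\<dots> = (if y = y' then 1 + \<rho>\<^sup>2 else 1)"
    using finite_X X_ne assms by (simp add: mean_sign_sign sign_square mean_const)
  finally have "mean X (\<lambda>x. (1 + \<rho> * \<xi> x y) * (1 + \<rho> * \<xi> x y')) = (if y = y' then 1 + \<rho>\<^sup>2 else 1)" .
  then show ?thesis
    using mean_tuples_prod[OF finite_X, of k "\<lambda>x. (1 + \<rho> * \<xi> x y) * (1 + \<rho> * \<xi> x y')"]
    by (simp add: tilt_def prod.distrib)
qed

section \<open>Typical tuples: total mass, second moment and covariances of the tilted law\<close>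

definition mass :: "real \<Rightarrow> nat \<Rightarrow> (nat \<Rightarrow> 'a) \<Rightarrow> real" where
  "mass \<rho> k S = mean Y (tilt \<rho> k S)"

text \<open>If \<open>S\<close> is drawn from the tilted law at \<open>y\<close>, the signs are
  independent with mean \<open>\<rho>\<close>. This is what remains of their covariance when
  \<open>S\<close> is fixed and \<open>y\<close> varies, before division by the mass.\<close>

definition covar :: "real \<Rightarrow> nat \<Rightarrow> (nat \<Rightarrow> 'a) \<Rightarrow> nat \<Rightarrow> nat \<Rightarrow> real" where
  "covar \<rho> k S i j = mean Y (\<lambda>y. tilt \<rho> k S y * ((\<xi> (S i) y - \<rho>) * (\<xi> (S j) y - \<rho>)))"

text \<open>The first clause turns missed mass into mass on \<open>\<Phi>\<close>, the second bounds
  the Fourier coefficients of the restricted law, the third bounds the bias that restricting to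
  \<open>\<Phi>\<close> can create. Each one fails for at most a hundredth of the tuples, by
  Markov.\<close>

definition typical :: "real \<Rightarrow> nat \<Rightarrow> (nat \<Rightarrow> 'a) \<Rightarrow> bool" where
  "typical \<rho> k S \<longleftrightarrow> \<bar>mass \<rho> k S - 1\<bar> \<le> 1/10 \<and>
     mean Y (\<lambda>y. (tilt \<rho> k S y)\<^sup>2) \<le> 100 * (1 + \<rho>\<^sup>2) ^ k \<and>
     (\<Sum>i<k. \<Sum>j\<in>{..<k} - {i}. (covar \<rho> k S i j)\<^sup>2) \<le> 1"

lemma mean_mass: "mean (tuples k X) (mass \<rho> k) = 1"
proof -
  have "mean (tuples k X) (mass \<rho> k) = mean Y (\<lambda>y. mean (tuples k X) (\<lambda>S. tilt \<rho> k S y))"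
    unfolding mass_def by (rule mean_swap)
  also have "\<dots> = mean Y (\<lambda>y. 1)" by (rule mean_cong) (simp add: mean_tilt)
  finally show ?thesis by (simp add: mean_const finite_Y Y_ne)
qed

text \<open>Pairs of distinct \<open>y\<close> contribute exactly 1, so only the diagonal deviates.
  It is negligible as long as \<open>\<rho>\<^sup>2 * k\<close> is a small fraction of
  \<open>n\<close>.\<close>

lemma mean_mass_deviation:
  "mean (tuples k X) (\<lambda>S. (mass \<rho> k S - 1)\<^sup>2) \<le> (1 + \<rho>\<^sup>2) ^ k / real (card Y)"
proof -
  have "mean (tuples k X) (\<lambda>S. (mass \<rho> k S)\<^sup>2) =
        mean (tuples k X) (\<lambda>S. mean Y (\<lambda>y. mean Y (\<lambda>y'. tilt \<rho> k S y * tilt \<rho> k S y')))"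
    by (simp add: power2_eq_square mass_def mean_mult_mean)
  also have "\<dots> = mean Y (\<lambda>y. mean Y (\<lambda>y'. mean (tuples k X) (\<lambda>S. tilt \<rho> k S y * tilt \<rho> k S y')))"
    by (simp add: mean_swap[of "tuples k X"])
  also have "\<dots> \<le> 1 + \<bar>(1 + \<rho>\<^sup>2) ^ k\<bar> / real (card Y)"
    by (rule mean_mean_le_diagonal) (auto simp: finite_Y Y_ne mean_tilt_tilt)
  finally have "mean (tuples k X) (\<lambda>S. (mass \<rho> k S)\<^sup>2) \<le> 1 + (1 + \<rho>\<^sup>2) ^ k / real (card Y)"
    by simp
  moreover have "mean (tuples k X) (\<lambda>S. (mass \<rho> k S - 1)\<^sup>2) =
      mean (tuples k X) (\<lambda>S. (mass \<rho> k S)\<^sup>2 + (-2 * mass \<rho> k S + 1))"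
    by (simp add: power2_diff algebra_simps)
  moreover have "\<dots> = mean (tuples k X) (\<lambda>S. (mass \<rho> k S)\<^sup>2) - 1"
    by (simp only: mean_add mean_cmult mean_mass)
      (simp add: mean_const finite_tuples finite_X tuples_nonempty X_ne)
  ultimately show ?thesis by simp
qed

lemma mean_tilt_square:
  "mean (tuples k X) (\<lambda>S. mean Y (\<lambda>y. (tilt \<rho> k S y)\<^sup>2)) = (1 + \<rho>\<^sup>2) ^ k"
proof -
  have "mean (tuples k X) (\<lambda>S. mean Y (\<lambda>y. (tilt \<rho> k S y)\<^sup>2)) =
        mean Y (\<lambda>y. mean (tuples k X) (\<lambda>S. tilt \<rho> k S y * tilt \<rho> k S y))"
    by (subst mean_swap) (simp add: power2_eq_square)
  also have "\<dots> = mean Y (\<lambda>y. (1 + \<rho>\<^sup>2) ^ k)" by (rule mean_cong) (simp add: mean_tilt_tilt)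
  finally show ?thesis by (simp add: mean_const finite_Y Y_ne)
qed

lemma abs_sign_minus_le: "0 \<le> \<rho> \<Longrightarrow> \<rho> \<le> 1 \<Longrightarrow> \<bar>\<xi> x y - \<rho>\<bar> \<le> 2"
  using sign_cases[of x y] by auto

lemma sign_minus_square_le: "0 \<le> \<rho> \<Longrightarrow> \<rho> \<le> 1 \<Longrightarrow> (\<xi> x y - \<rho>)\<^sup>2 \<le> 4"
  using power_mono[OF abs_sign_minus_le[of \<rho> x y], of 2] by simp

lemma mean_covar_square:
  assumes "0 \<le> \<rho>" "\<rho> \<le> 1" "i < k" "j < k" "i \<noteq> j"
  shows "mean (tuples k X) (\<lambda>S. (covar \<rho> k S i j)\<^sup>2) \<le> 16 * (1 + \<rho>\<^sup>2) ^ k / real (card Y)"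
proof -
  define f where "f S y = tilt \<rho> k S y * ((\<xi> (S i) y - \<rho>) * (\<xi> (S j) y - \<rho>))" for S y
  have "mean (tuples k X) (\<lambda>S. (covar \<rho> k S i j)\<^sup>2) =
        mean (tuples k X) (\<lambda>S. mean Y (\<lambda>y. mean Y (\<lambda>y'. f S y * f S y')))"
    by (simp add: power2_eq_square covar_def f_def[symmetric] mean_mult_mean)
  also have "\<dots> = mean Y (\<lambda>y. mean Y (\<lambda>y'. mean (tuples k X) (\<lambda>S. f S y * f S y')))"
    by (simp add: mean_swap[of "tuples k X"])
  also have "\<dots> \<le> 0 + \<bar>16 * (1 + \<rho>\<^sup>2) ^ k\<bar> / real (card Y)"
  proof (rule mean_mean_le_diagonal)
    fix y y' assume y: "y \<in> Y" "y' \<in> Y" "y \<noteq> y'"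
    define q where "q x = (1 + \<rho> * \<xi> x y) * (1 + \<rho> * \<xi> x y')" for x
    define g where "g x = (\<xi> x y - \<rho>) * (\<xi> x y' - \<rho>)" for x
    \<comment> \<open>Since the signs square to 1, \<open>(1 + \<rho> * \<xi>) * (\<xi> - \<rho>) =
      (1 - \<rho>\<^sup>2) * \<xi>\<close>: centring turns the tilted factor into a multiple of the
      sign itself.\<close>
    have "q x * g x = (1 - \<rho>\<^sup>2)\<^sup>2 * (\<xi> x y * \<xi> x y')" for x
      using sign_cases[of x y] sign_cases[of x y']
      by (auto simp: q_def g_def power2_eq_square algebra_simps)
    then have "(\<Sum>x\<in>X. q x * g x) = (1 - \<rho>\<^sup>2)\<^sup>2 * (\<Sum>x\<in>X. \<xi> x y * \<xi> x y')"
      by (simp add: sum_distrib_left)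
    also have "(\<Sum>x\<in>X. \<xi> x y * \<xi> x y') = 0"
      using mean_sign_sign[OF y] finite_X X_ne by (simp add: mean_def)
    finally have 0: "(\<Sum>x\<in>X. q x * g x) = 0" by simp
    have "(\<Sum>S\<in>tuples k X. f S y * f S y') = (\<Sum>S\<in>tuples k X. (\<Prod>l<k. q (S l)) * (g (S i) * g (S j)))"
      by (rule sum.cong) (simp_all add: f_def tilt_def q_def g_def prod.distrib mult_ac)
    also have "\<dots> = 0" using 0 assms by (simp add: sum_tuples_prod_at2 finite_X)
    finally show "mean (tuples k X) (\<lambda>S. f S y * f S y') \<le> 0" by (simp add: mean_def)
  next
    fix y assume y: "y \<in> Y"
    have "f S y * f S y \<le> 16 * (tilt \<rho> k S y * tilt \<rho> k S y)" for S
    proof -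
      have "f S y * f S y = (tilt \<rho> k S y)\<^sup>2 * ((\<xi> (S i) y - \<rho>)\<^sup>2 * (\<xi> (S j) y - \<rho>)\<^sup>2)"
        by (simp add: f_def power2_eq_square)
      also have "\<dots> \<le> (tilt \<rho> k S y)\<^sup>2 * (4 * 4)"
        using assms by (intro mult_left_mono mult_mono sign_minus_square_le) auto
      finally show ?thesis by (simp add: power2_eq_square)
    qed
    then have "mean (tuples k X) (\<lambda>S. f S y * f S y) \<le> mean (tuples k X) (\<lambda>S. 16 * (tilt \<rho> k S y * tilt \<rho> k S y))"
      by (intro mean_mono)
    also have "\<dots> = 16 * (1 + \<rho>\<^sup>2) ^ k"
      using y by (simp add: mean_cmult mean_tilt_tilt)
    finally show "mean (tuples k X) (\<lambda>S. f S y * f S y) \<le> 16 * (1 + \<rho>\<^sup>2) ^ k" .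
  qed (auto simp: finite_Y Y_ne)
  finally show ?thesis by simp
qed

lemma mean_not_typical:
  assumes \<rho>: "0 \<le> \<rho>" "\<rho> \<le> 1" and k: "1 \<le> k"
    and big: "10000 * (real k)\<^sup>2 * (1 + \<rho>\<^sup>2) ^ k \<le> real (card Y)"
  shows "mean (tuples k X) (\<lambda>S. of_bool (\<not> typical \<rho> k S)) \<le> 3/100"
proof -
  let ?P = "tuples k X"
  define V where "V = (1 + \<rho>\<^sup>2) ^ k"
  have V: "V > 0" by (simp add: V_def add_pos_nonneg)
  have D: "0 < real (card Y)" using finite_Y Y_ne by (simp add: card_gt_0_iff)
  have VD: "10000 * (real k)\<^sup>2 * V / card Y \<le> 1"
    using big D by (simp add: V_def)
  have "1 * V \<le> (real k)\<^sup>2 * V" using k V by (intro mult_right_mono) auto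
  then have VD1: "10000 * V / card Y \<le> 1"
    using big D by (simp add: V_def)
  have "mean ?P (\<lambda>S. of_bool (1/100 < (mass \<rho> k S - 1)\<^sup>2)) \<le> mean ?P (\<lambda>S. (mass \<rho> k S - 1)\<^sup>2) / (1/100)"
    by (rule mean_markov) auto
  also have "\<dots> \<le> (V / card Y) / (1/100)"
    unfolding V_def by (intro divide_right_mono mean_mass_deviation) simp
  also have "\<dots> \<le> 1/100" using VD1 by simp
  finally have 1: "mean ?P (\<lambda>S. of_bool (1/100 < (mass \<rho> k S - 1)\<^sup>2)) \<le> 1/100" .
  have "mean ?P (\<lambda>S. of_bool (100 * V < mean Y (\<lambda>y. (tilt \<rho> k S y)\<^sup>2)))
      \<le> mean ?P (\<lambda>S. mean Y (\<lambda>y. (tilt \<rho> k S y)\<^sup>2)) / (100 * V)"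
    using V by (intro mean_markov mean_nonneg) auto
  also have "\<dots> = 1/100" using V by (simp add: mean_tilt_square V_def[symmetric])
  finally have 2: "mean ?P (\<lambda>S. of_bool (100 * V < mean Y (\<lambda>y. (tilt \<rho> k S y)\<^sup>2))) \<le> 1/100" .
  let ?c = "\<lambda>S. \<Sum>i<k. \<Sum>j\<in>{..<k} - {i}. (covar \<rho> k S i j)\<^sup>2"
  have "mean ?P ?c = (\<Sum>i<k. \<Sum>j\<in>{..<k} - {i}. mean ?P (\<lambda>S. (covar \<rho> k S i j)\<^sup>2))"
    by (simp add: mean_sum)
  also have "\<dots> \<le> (\<Sum>i<k. \<Sum>j\<in>{..<k} - {i}. 16 * V / card Y)"
    unfolding V_def using \<rho> by (intro sum_mono mean_covar_square) auto
  also have "\<dots> \<le> (\<Sum>i<k. \<Sum>j<k. 16 * V / card Y)"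
    using V by (intro sum_mono sum_mono2) auto
  also have "\<dots> = 16 * (real k)\<^sup>2 * V / card Y" by (simp add: power2_eq_square)
  also have "\<dots> \<le> 1/100"
    using VD by (simp add: mult.assoc)
  finally have 3: "mean ?P (\<lambda>S. of_bool (1 < ?c S)) \<le> 1/100"
    using mean_markov[of ?P ?c 1] by (auto simp: sum_nonneg)
  have "of_bool (\<not> typical \<rho> k S) \<le> of_bool (1/100 < (mass \<rho> k S - 1)\<^sup>2) +
      (of_bool (100 * V < mean Y (\<lambda>y. (tilt \<rho> k S y)\<^sup>2)) + (of_bool (1 < ?c S) :: real))" for S
  proof -
    have "\<bar>mass \<rho> k S - 1\<bar> \<le> 1/10" if "\<not> 1/100 < (mass \<rho> k S - 1)\<^sup>2"
      using that power2_le_iff_abs_le[of "1/10" "mass \<rho> k S - 1"] by (simp add: power2_eq_square)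
    then show ?thesis unfolding typical_def V_def by (auto simp: not_less)
  qed
  then have "mean ?P (\<lambda>S. of_bool (\<not> typical \<rho> k S)) \<le> mean ?P (\<lambda>S. of_bool (1/100 < (mass \<rho> k S - 1)\<^sup>2) +
      (of_bool (100 * V < mean Y (\<lambda>y. (tilt \<rho> k S y)\<^sup>2)) + (of_bool (1 < ?c S) :: real)))"
    by (intro mean_mono)
  also have "\<dots> \<le> 1/100 + (1/100 + 1/100)"
    using 1 2 3 by (simp only: mean_add)
  finally show ?thesis by simp
qed

section \<open>The likelihood as a function of Alice's points, and its truncation\<close>

definition dual_tilt :: "real \<Rightarrow> nat \<Rightarrow> (nat \<Rightarrow> 'b) \<Rightarrow> 'a \<Rightarrow> real" where
  "dual_tilt \<rho> t T x = (\<Prod>s<t. 1 + \<rho> * \<xi> x (T s))"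

text \<open>The cap limits the contribution of those \<open>x\<close> that correlate with
  \<open>T\<close> far beyond \<open>\<rho>\<close>; it is the square of
  \<open>exp (\<rho>\<^sup>2 * t)\<close>, the size expected at correlation \<open>\<rho>\<close>.
  The floor keeps products positive and adds at most 1 to the mean.\<close>

definition clipped_tilt :: "real \<Rightarrow> nat \<Rightarrow> (nat \<Rightarrow> 'b) \<Rightarrow> 'a \<Rightarrow> real" where
  "clipped_tilt \<rho> t T x = max 1 (min (dual_tilt \<rho> t T x) (exp (2 * \<rho>\<^sup>2 * real t)))"

lemma dual_tilt_nonneg: "0 \<le> \<rho> \<Longrightarrow> \<rho> \<le> 1 \<Longrightarrow> 0 \<le> dual_tilt \<rho> t T x"
  unfolding dual_tilt_def by (intro prod_nonneg) (simp add: tilt_factor_nonneg)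

lemma prod_tilt_eq_prod_dual_tilt:
  "(\<Prod>s<t. tilt \<rho> k S (T s)) = (\<Prod>i<k. dual_tilt \<rho> t T (S i))"
  unfolding tilt_def dual_tilt_def by (rule prod.swap)

lemma dual_tilt_le_clipped_tilt:
  assumes \<rho>: "0 \<le> \<rho>" "\<rho> \<le> 1" and t: "1 \<le> t"
  shows "dual_tilt \<rho> t T x \<le> clipped_tilt \<rho> t T x * exp ((\<Sum>s<t. \<xi> x (T s) - \<rho>)\<^sup>2 / (4 * real t))"
proof -
  define d where "d = (\<Sum>s<t. \<xi> x (T s) - \<rho>)"
  have d: "(\<Sum>s<t. \<xi> x (T s)) = d + \<rho> * real t" by (simp add: d_def sum_subtractf)
  have "dual_tilt \<rho> t T x \<le> (\<Prod>s<t. exp (\<rho> * \<xi> x (T s)))"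
    unfolding dual_tilt_def using \<rho>
    by (intro prod_mono conjI tilt_factor_nonneg) auto
  also have "\<dots> = exp (\<rho> * (d + \<rho> * real t))"
    by (simp add: exp_sum[symmetric] sum_distrib_left[symmetric] d)
  finally have le: "dual_tilt \<rho> t T x \<le> exp (\<rho> * (d + \<rho> * real t))" .
  \<comment> \<open>This is what makes the truncation in the clipped tilt affordable.\<close>
  have amgm: "\<rho> * d - \<rho>\<^sup>2 * real t \<le> d\<^sup>2 / (4 * real t)"
  proof -
    have "0 \<le> (d - 2 * \<rho> * real t)\<^sup>2" by simp
    then have "(\<rho> * d - \<rho>\<^sup>2 * real t) * (4 * real t) \<le> d\<^sup>2"
      by (simp add: power2_eq_square algebra_simps)
    then show ?thesis using t by (simp add: pos_le_divide_eq)
  qed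
  show ?thesis
  proof (cases "dual_tilt \<rho> t T x \<le> exp (2 * \<rho>\<^sup>2 * real t)")
    case True
    then have "dual_tilt \<rho> t T x \<le> clipped_tilt \<rho> t T x * 1"
      by (simp add: clipped_tilt_def)
    also have "\<dots> \<le> clipped_tilt \<rho> t T x * exp ((\<Sum>s<t. \<xi> x (T s) - \<rho>)\<^sup>2 / (4 * real t))"
      by (intro mult_left_mono) (auto simp: clipped_tilt_def)
    finally show ?thesis .
  next
    case False
    have "dual_tilt \<rho> t T x \<le> exp (2 * \<rho>\<^sup>2 * real t + (\<rho> * d - \<rho>\<^sup>2 * real t))"
      using le by (simp add: power2_eq_square algebra_simps)
    also have "\<dots> \<le> exp (2 * \<rho>\<^sup>2 * real t + d\<^sup>2 / (4 * real t))"
      using amgm by (simp only: exp_le_cancel_iff add_le_cancel_left)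
    also have "\<dots> = exp (2 * \<rho>\<^sup>2 * real t) * exp (d\<^sup>2 / (4 * real t))" by (rule exp_add)
    also have "\<dots> \<le> clipped_tilt \<rho> t T x * exp (d\<^sup>2 / (4 * real t))"
      using False by (intro mult_right_mono) (auto simp: clipped_tilt_def)
    finally show ?thesis by (simp add: d_def)
  qed
qed

section \<open>The tilted law restricted to a heavy set, and independent samples from it\<close>

definition posterior :: "real \<Rightarrow> nat \<Rightarrow> (nat \<Rightarrow> 'a) \<Rightarrow> 'b set \<Rightarrow> 'b \<Rightarrow> real" where
  "posterior \<rho> k S \<Phi> y = tilt \<rho> k S y / (\<Sum>z\<in>\<Phi>. tilt \<rho> k S z)"

lemma posterior_nonneg:
  assumes "0 \<le> \<rho>" "\<rho> \<le> 1"
  shows "0 \<le> posterior \<rho> k S \<Phi> y"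
  unfolding posterior_def using assms by (simp add: tilt_nonneg sum_nonneg)

lemma card_Y_pos: "0 < real (card Y)"
  using finite_Y Y_ne by (simp add: card_gt_0_iff)

context
  fixes \<rho> :: real and k :: nat and S :: "nat \<Rightarrow> 'a" and \<Phi> :: "'b set"
  assumes \<rho>: "0 < \<rho>" "\<rho> \<le> 1" and typS: "typical \<rho> k S" and sub: "\<Phi> \<subseteq> Y"
    and heavy: "3/10 * real (card Y) \<le> (\<Sum>y\<in>\<Phi>. tilt \<rho> k S y)"
begin

private lemma tilt_sum_pos: "0 < (\<Sum>y\<in>\<Phi>. tilt \<rho> k S y)"
  using heavy card_Y_pos by linarith

lemma sum_posterior: "(\<Sum>y\<in>\<Phi>. posterior \<rho> k S \<Phi> y) = 1"
  using tilt_sum_pos by (simp add: posterior_def sum_divide_distrib[symmetric])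

text \<open>The normalising constant is at least \<open>3/10 * card Y\<close>, so conditioning on
  \<open>\<Phi>\<close> inflates a nonnegative expectation by at most \<open>10/3\<close>.\<close>

lemma posterior_expectation_le:
  assumes "\<And>y. y \<in> Y \<Longrightarrow> 0 \<le> f y"
  shows "(\<Sum>y\<in>\<Phi>. posterior \<rho> k S \<Phi> y * f y) \<le> 10/3 * mean Y (\<lambda>y. tilt \<rho> k S y * f y)"
proof -
  let ?s = "\<Sum>y\<in>\<Phi>. tilt \<rho> k S y"
  have "(\<Sum>y\<in>\<Phi>. posterior \<rho> k S \<Phi> y * f y) = (\<Sum>y\<in>\<Phi>. tilt \<rho> k S y * f y) / ?s"
    by (simp add: posterior_def sum_divide_distrib)
  also have "\<dots> \<le> (\<Sum>y\<in>Y. tilt \<rho> k S y * f y) / (3/10 * real (card Y))"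
    using heavy card_Y_pos assms \<rho> sub finite_Y
    by (intro frac_le sum_nonneg mult_nonneg_nonneg sum_mono2) (auto simp: tilt_nonneg)
  finally show ?thesis by (simp add: mean_def)
qed

text \<open>Duality: test the biases \<open>e\<close> against themselves. Their square sum
  \<open>q\<close> is the posterior mean of the linear form \<open>g\<close> with coefficients
  \<open>e\<close>, so \<open>q\<^sup>2\<close> is at most the posterior mean of
  \<open>g\<^sup>2\<close>. Passing to the unrestricted tilted law costs \<open>10/3\<close>, and
  there the signs are almost uncorrelated: diagonal and off-diagonal terms give
  \<open>44/10 * q\<close> and \<open>q\<close>. Hence \<open>18 = 10/3 * 54/10\<close>, whatever
  \<open>k\<close> is.\<close>

lemma sum_posterior_deviation_square:
  "(\<Sum>i<k. (\<Sum>y\<in>\<Phi>. posterior \<rho> k S \<Phi> y * (\<xi> (S i) y - \<rho>))\<^sup>2) \<le> 18"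
proof -
  define \<nu> where "\<nu> = posterior \<rho> k S \<Phi>"
  define e where "e i = (\<Sum>y\<in>\<Phi>. \<nu> y * (\<xi> (S i) y - \<rho>))" for i
  define q where "q = (\<Sum>i<k. (e i)\<^sup>2)"
  define g where "g y = (\<Sum>i<k. e i * (\<xi> (S i) y - \<rho>))" for y
  have q0: "0 \<le> q" by (simp add: q_def sum_nonneg)
  have "q = (\<Sum>i<k. \<Sum>y\<in>\<Phi>. \<nu> y * (e i * (\<xi> (S i) y - \<rho>)))"
    unfolding q_def power2_eq_square
    by (rule sum.cong[OF refl], subst (2) e_def) (simp add: sum_distrib_left mult_ac)
  also have "\<dots> = (\<Sum>y\<in>\<Phi>. \<nu> y * g y)"
    by (subst sum.swap) (simp add: g_def sum_distrib_left)
  finally have qg: "q = (\<Sum>y\<in>\<Phi>. \<nu> y * g y)" .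
  have "0 \<le> (\<Sum>y\<in>\<Phi>. \<nu> y * (g y - q)\<^sup>2)"
    unfolding \<nu>_def using \<rho> by (intro sum_nonneg mult_nonneg_nonneg posterior_nonneg) auto
  also have "\<dots> = (\<Sum>y\<in>\<Phi>. \<nu> y * (g y)\<^sup>2 - 2 * q * (\<nu> y * g y) + q\<^sup>2 * \<nu> y)"
    by (simp add: power2_eq_square algebra_simps)
  also have "\<dots> = (\<Sum>y\<in>\<Phi>. \<nu> y * (g y)\<^sup>2) - 2 * q * (\<Sum>y\<in>\<Phi>. \<nu> y * g y) + q\<^sup>2 * (\<Sum>y\<in>\<Phi>. \<nu> y)"
    by (simp add: sum.distrib sum_subtractf sum_distrib_left)
  also have "\<dots> = (\<Sum>y\<in>\<Phi>. \<nu> y * (g y)\<^sup>2) - q\<^sup>2"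
    using sum_posterior by (simp only: qg[symmetric] \<nu>_def[symmetric]) (simp add: power2_eq_square)
  finally have "q\<^sup>2 \<le> (\<Sum>y\<in>\<Phi>. \<nu> y * (g y)\<^sup>2)" by simp
  also have "\<dots> \<le> 10/3 * mean Y (\<lambda>y. tilt \<rho> k S y * (g y)\<^sup>2)"
    unfolding \<nu>_def by (rule posterior_expectation_le) simp
  also have "mean Y (\<lambda>y. tilt \<rho> k S y * (g y)\<^sup>2) =
      mean Y (\<lambda>y. \<Sum>i<k. \<Sum>j<k. (e i * e j) * (tilt \<rho> k S y * ((\<xi> (S i) y - \<rho>) * (\<xi> (S j) y - \<rho>))))"
    unfolding g_def power2_eq_square sum_product
    by (simp add: sum_distrib_left mult_ac)
  also have "\<dots> = (\<Sum>i<k. \<Sum>j<k. e i * e j * covar \<rho> k S i j)"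
    by (simp only: mean_sum mean_cmult covar_def)
  also have "\<dots> = (\<Sum>i<k. (e i)\<^sup>2 * covar \<rho> k S i i + (\<Sum>j\<in>{..<k} - {i}. e i * e j * covar \<rho> k S i j))"
    by (intro sum.cong refl) (simp add: sum.remove power2_eq_square)
  also have "\<dots> = (\<Sum>i<k. (e i)\<^sup>2 * covar \<rho> k S i i) + (\<Sum>i<k. \<Sum>j\<in>{..<k} - {i}. e i * e j * covar \<rho> k S i j)"
    by (rule sum.distrib)
  finally have main: "q\<^sup>2 \<le> 10/3 * ((\<Sum>i<k. (e i)\<^sup>2 * covar \<rho> k S i i) +
      (\<Sum>i<k. \<Sum>j\<in>{..<k} - {i}. e i * e j * covar \<rho> k S i j))" .
  have mass: "mass \<rho> k S \<le> 11/10" using typS unfolding typical_def abs_le_iff by linarith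
  have "covar \<rho> k S i i \<le> 44/10" for i
  proof -
    have "covar \<rho> k S i i \<le> mean Y (\<lambda>y. 4 * tilt \<rho> k S y)"
      unfolding covar_def
    proof (rule mean_mono)
      fix y
      show "tilt \<rho> k S y * ((\<xi> (S i) y - \<rho>) * (\<xi> (S i) y - \<rho>)) \<le> 4 * tilt \<rho> k S y"
        using mult_left_mono[OF sign_minus_square_le[of \<rho> "S i" y] tilt_nonneg[of \<rho> k S y]] \<rho>
        by (simp add: power2_eq_square mult_ac)
    qed
    also have "\<dots> = 4 * mass \<rho> k S" by (simp add: mean_cmult mass_def)
    finally show ?thesis using mass by simp
  qed
  then have "(\<Sum>i<k. (e i)\<^sup>2 * covar \<rho> k S i i) \<le> (\<Sum>i<k. (e i)\<^sup>2 * (44/10))"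
    by (intro sum_mono mult_left_mono) auto
  then have diag: "(\<Sum>i<k. (e i)\<^sup>2 * covar \<rho> k S i i) \<le> 44/10 * q"
    unfolding q_def sum_distrib_right[symmetric] by (simp only: mult.commute)
  show ?thesis
  proof (cases "q = 0")
    case True
    then show ?thesis by (simp add: q_def e_def \<nu>_def)
  next
    case False
    then have qp: "q > 0" using q0 by simp
    \<comment> \<open>The weights balance the two sums: squared covariances add up to at most 1 and
      the products \<open>(e i)\<^sup>2 * (e j)\<^sup>2\<close> to at most \<open>q\<^sup>2\<close>,
      so each half contributes \<open>q / 2\<close>.\<close>
    have "e i * e j * covar \<rho> k S i j \<le> q / 2 * (covar \<rho> k S i j)\<^sup>2 + (e i)\<^sup>2 * (e j)\<^sup>2 / (2 * q)" for i j
    proof -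
      have "0 \<le> (q * covar \<rho> k S i j - e i * e j)\<^sup>2" by simp
      then show ?thesis using qp by (simp add: field_simps power2_eq_square)
    qed
    then have "(\<Sum>i<k. \<Sum>j\<in>{..<k} - {i}. e i * e j * covar \<rho> k S i j) \<le>
        (\<Sum>i<k. \<Sum>j\<in>{..<k} - {i}. q / 2 * (covar \<rho> k S i j)\<^sup>2 + (e i)\<^sup>2 * (e j)\<^sup>2 / (2 * q))"
      by (intro sum_mono)
    also have "\<dots> = q / 2 * (\<Sum>i<k. \<Sum>j\<in>{..<k} - {i}. (covar \<rho> k S i j)\<^sup>2) +
        (\<Sum>i<k. \<Sum>j\<in>{..<k} - {i}. (e i)\<^sup>2 * (e j)\<^sup>2 / (2 * q))"
      by (simp add: sum.distrib sum_distrib_left)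
    also have "\<dots> \<le> q / 2 * 1 + (\<Sum>i<k. \<Sum>j<k. (e i)\<^sup>2 * (e j)\<^sup>2 / (2 * q))"
      using typS qp by (intro add_mono mult_left_mono sum_mono sum_mono2) (auto simp: typical_def)
    also have "(\<Sum>i<k. \<Sum>j<k. (e i)\<^sup>2 * (e j)\<^sup>2 / (2 * q)) = q * q / (2 * q)"
      unfolding q_def sum_product by (simp add: sum_divide_distrib)
    finally have "(\<Sum>i<k. \<Sum>j\<in>{..<k} - {i}. e i * e j * covar \<rho> k S i j) \<le> q"
      using qp by simp
    then have "q * q \<le> 18 * q" using main diag by (simp add: power2_eq_square)
    then have "q \<le> 18" using qp by simp
    then show ?thesis by (simp add: q_def e_def \<nu>_def)
  qed
qed

text \<open>The variances give \<open>4 * k * t\<close>, at most \<open>4 * t\<^sup>2\<close>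
  because \<open>k \<le> t\<close>; the biases give \<open>18 * t\<^sup>2\<close>. Bounding each
  bias separately would cost another factor \<open>k\<close>.\<close>

lemma posterior_sample_deviation:
  assumes "k \<le> t"
  shows "(\<Sum>T\<in>tuples t \<Phi>. (\<Prod>s<t. posterior \<rho> k S \<Phi> (T s)) * (\<Sum>i<k. (\<Sum>s<t. \<xi> (S i) (T s) - \<rho>)\<^sup>2))
    \<le> 22 * (real t)\<^sup>2"
proof -
  define \<nu> where "\<nu> = posterior \<rho> k S \<Phi>"
  have fin: "finite \<Phi>" using sub finite_Y by (rule finite_subset)
  have nu: "(\<Sum>y\<in>\<Phi>. \<nu> y) = 1" using sum_posterior by (simp add: \<nu>_def)
  have "(\<Sum>T\<in>tuples t \<Phi>. (\<Prod>s<t. \<nu> (T s)) * (\<Sum>i<k. (\<Sum>s<t. \<xi> (S i) (T s) - \<rho>)\<^sup>2)) =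
      (\<Sum>i<k. \<Sum>T\<in>tuples t \<Phi>. (\<Prod>s<t. \<nu> (T s)) * (\<Sum>s<t. \<xi> (S i) (T s) - \<rho>)\<^sup>2)"
    by (subst sum.swap) (simp add: sum_distrib_left)
  also have "\<dots> = (\<Sum>i<k. real t * (\<Sum>y\<in>\<Phi>. \<nu> y * (\<xi> (S i) y - \<rho>)\<^sup>2) +
      real t * (real t - 1) * (\<Sum>y\<in>\<Phi>. \<nu> y * (\<xi> (S i) y - \<rho>))\<^sup>2)"
    by (intro sum.cong refl) (rule sum_tuples_second_moment[OF fin nu])
  also have "\<dots> \<le> (\<Sum>i<k. real t * 4 + real t * real t * (\<Sum>y\<in>\<Phi>. \<nu> y * (\<xi> (S i) y - \<rho>))\<^sup>2)"
  proof (intro sum_mono add_mono mult_left_mono mult_right_mono)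
    fix i
    have "(\<Sum>y\<in>\<Phi>. \<nu> y * (\<xi> (S i) y - \<rho>)\<^sup>2) \<le> (\<Sum>y\<in>\<Phi>. \<nu> y * 4)"
      unfolding \<nu>_def using \<rho>
      by (intro sum_mono mult_left_mono sign_minus_square_le posterior_nonneg) auto
    then show "(\<Sum>y\<in>\<Phi>. \<nu> y * (\<xi> (S i) y - \<rho>)\<^sup>2) \<le> 4"
      using nu by (simp add: sum_distrib_right[symmetric])
  qed auto
  also have "\<dots> = 4 * (real k * real t) + real t * real t * (\<Sum>i<k. (\<Sum>y\<in>\<Phi>. \<nu> y * (\<xi> (S i) y - \<rho>))\<^sup>2)"
    by (simp add: sum.distrib sum_distrib_left)
  also have "\<dots> \<le> 4 * (real t * real t) + real t * real t * 18"
    using assms sum_posterior_deviation_square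
    by (intro add_mono mult_left_mono mult_right_mono) (auto simp: \<nu>_def)
  finally show ?thesis by (simp add: \<nu>_def power2_eq_square)
qed

text \<open>The functions \<open>\<xi> _ y\<close> are orthonormal over \<open>X\<close>, so by
  Parseval the left side is the collision probability of the posterior. The second moment clause of
  \<open>typical\<close> bounds it, and \<open>100 * 100/9\<close> is rounded up to 1200.\<close>

lemma mean_posterior_fourier_square:
  "mean X (\<lambda>x. (\<Sum>y\<in>\<Phi>. posterior \<rho> k S \<Phi> y * \<xi> x y)\<^sup>2)
    \<le> 1200 * (1 + \<rho>\<^sup>2) ^ k / real (card Y)"
proof -
  define \<nu> where "\<nu> = posterior \<rho> k S \<Phi>"
  have fin: "finite \<Phi>" using sub finite_Y by (rule finite_subset)
  have "mean X (\<lambda>x. (\<Sum>y\<in>\<Phi>. \<nu> y * \<xi> x y)\<^sup>2) =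
      mean X (\<lambda>x. \<Sum>y\<in>\<Phi>. \<Sum>z\<in>\<Phi>. (\<nu> y * \<nu> z) * (\<xi> x y * \<xi> x z))"
    unfolding power2_eq_square sum_product by (simp add: mult_ac)
  also have "\<dots> = (\<Sum>y\<in>\<Phi>. \<Sum>z\<in>\<Phi>. (\<nu> y * \<nu> z) * mean X (\<lambda>x. \<xi> x y * \<xi> x z))"
    by (simp only: mean_sum mean_cmult)
  also have "\<dots> = (\<Sum>y\<in>\<Phi>. \<Sum>z\<in>\<Phi>. if z = y then (\<nu> y)\<^sup>2 else 0)"
    using sub by (intro sum.cong refl)
      (auto simp: mean_sign_sign sign_square mean_const finite_X X_ne power2_eq_square subset_iff)
  also have "\<dots> = (\<Sum>y\<in>\<Phi>. (\<nu> y)\<^sup>2)" using fin by simp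
  also have "\<dots> = (\<Sum>y\<in>\<Phi>. (tilt \<rho> k S y)\<^sup>2) / (\<Sum>y\<in>\<Phi>. tilt \<rho> k S y)\<^sup>2"
    by (simp add: \<nu>_def posterior_def power_divide sum_divide_distrib)
  also have "\<dots> \<le> (\<Sum>y\<in>Y. (tilt \<rho> k S y)\<^sup>2) / (3/10 * real (card Y))\<^sup>2"
    using heavy card_Y_pos sub finite_Y
    by (intro frac_le sum_mono2 power_mono sum_nonneg) auto
  also have "\<dots> = mean Y (\<lambda>y. (tilt \<rho> k S y)\<^sup>2) * (100/9) / real (card Y)"
    using card_Y_pos by (simp add: mean_def power2_eq_square)
  also have "\<dots> \<le> (100 * (1 + \<rho>\<^sup>2) ^ k) * 12 / real (card Y)"
    using typS card_Y_pos
    by (intro divide_right_mono mult_mono) (auto simp: typical_def)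
  finally show ?thesis by (simp add: \<nu>_def)
qed

text \<open>For \<open>x\<close> whose Fourier coefficient \<open>F x\<close> is at most
  \<open>1 / (\<rho> * t)\<close>, the expected dual tilt is
  \<open>(1 + \<rho> * F x) ^ t \<le> exp 1\<close>. For every other \<open>x\<close> the cap
  \<open>E\<close> is at most \<open>E * (\<rho> * t * F x)\<^sup>2\<close>, whose mean over
  \<open>x\<close> is at most 1 by Parseval and \<open>big\<close>. Together with the floor this
  makes \<open>1 + 3 + 1\<close>.\<close>

lemma posterior_sample_clipped_tilt:
  assumes t: "1 \<le> t"
    and big: "1200 * (1 + \<rho>\<^sup>2) ^ k * \<rho>\<^sup>2 * (real t)\<^sup>2 * exp (2 * \<rho>\<^sup>2 * real t) \<le> real (card Y)"
  shows "(\<Sum>T\<in>tuples t \<Phi>. (\<Prod>s<t. posterior \<rho> k S \<Phi> (T s)) * mean X (clipped_tilt \<rho> t T)) \<le> 5"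
proof -
  define \<nu> where "\<nu> = posterior \<rho> k S \<Phi>"
  define E where "E = exp (2 * \<rho>\<^sup>2 * real t)"
  define F where "F x = (\<Sum>y\<in>\<Phi>. \<nu> y * \<xi> x y)" for x
  have fin: "finite \<Phi>" using sub finite_Y by (rule finite_subset)
  have nu: "(\<Sum>y\<in>\<Phi>. \<nu> y) = 1" using sum_posterior by (simp add: \<nu>_def)
  have nu0: "0 \<le> \<nu> y" for y using \<rho> by (simp add: \<nu>_def posterior_nonneg)
  have nuT: "(\<Sum>T\<in>tuples t \<Phi>. \<Prod>s<t. \<nu> (T s)) = 1"
    using fin nu by (simp add: sum_tuples_prod)
  have pt: "(\<Sum>T\<in>tuples t \<Phi>. (\<Prod>s<t. \<nu> (T s)) * clipped_tilt \<rho> t T x) \<le>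
      4 + E * (\<rho> * real t)\<^sup>2 * (F x)\<^sup>2" for x
  proof -
    have cl: "clipped_tilt \<rho> t T x \<le> 1 + min (dual_tilt \<rho> t T x) E" for T
      using dual_tilt_nonneg[of \<rho> t T x] \<rho> by (auto simp: clipped_tilt_def E_def)
    have "(\<Sum>T\<in>tuples t \<Phi>. (\<Prod>s<t. \<nu> (T s)) * clipped_tilt \<rho> t T x) \<le>
        (\<Sum>T\<in>tuples t \<Phi>. (\<Prod>s<t. \<nu> (T s)) * (1 + min (dual_tilt \<rho> t T x) E))"
      using nu0 cl by (intro sum_mono mult_left_mono prod_nonneg) auto
    also have "\<dots> = 1 + (\<Sum>T\<in>tuples t \<Phi>. (\<Prod>s<t. \<nu> (T s)) * min (dual_tilt \<rho> t T x) E)"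
      using nuT by (simp add: distrib_left sum.distrib)
    also have "(\<Sum>T\<in>tuples t \<Phi>. (\<Prod>s<t. \<nu> (T s)) * min (dual_tilt \<rho> t T x) E) \<le>
        3 + E * (\<rho> * real t)\<^sup>2 * (F x)\<^sup>2"
    proof (cases "F x \<le> 1 / (\<rho> * real t)")
      case True
      have "(\<Sum>T\<in>tuples t \<Phi>. (\<Prod>s<t. \<nu> (T s)) * min (dual_tilt \<rho> t T x) E) \<le>
          (\<Sum>T\<in>tuples t \<Phi>. (\<Prod>s<t. \<nu> (T s)) * dual_tilt \<rho> t T x)"
        using nu0 by (intro sum_mono mult_left_mono prod_nonneg) auto
      also have "\<dots> = (\<Sum>T\<in>tuples t \<Phi>. (\<Prod>s<t. \<nu> (T s) * (1 + \<rho> * \<xi> x (T s))))"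
        by (simp add: dual_tilt_def prod.distrib)
      also have "\<dots> = (\<Sum>y\<in>\<Phi>. \<nu> y * (1 + \<rho> * \<xi> x y)) ^ t"
        by (rule sum_tuples_prod[OF fin])
      also have "(\<Sum>y\<in>\<Phi>. \<nu> y * (1 + \<rho> * \<xi> x y)) = 1 + \<rho> * F x"
        using nu by (simp add: F_def distrib_left sum.distrib sum_distrib_left mult_ac)
      also have "(1 + \<rho> * F x) ^ t \<le> exp (\<rho> * F x) ^ t"
      proof (rule power_mono)
        have "0 \<le> (\<Sum>y\<in>\<Phi>. \<nu> y * (1 + \<rho> * \<xi> x y))"
          using nu0 \<rho> by (intro sum_nonneg mult_nonneg_nonneg tilt_factor_nonneg) auto
        then show "0 \<le> 1 + \<rho> * F x"
          using nu by (simp add: F_def distrib_left sum.distrib sum_distrib_left mult_ac)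
      qed (rule exp_ge_add_one_self)
      also have "\<dots> = exp (real t * \<rho> * F x)" by (simp add: exp_of_nat_mult[symmetric] mult_ac)
      also have "\<dots> \<le> exp 1"
        using True \<rho> t by (simp add: field_simps)
      also have "\<dots> \<le> 3" by (rule exp_le)
      also have "\<dots> \<le> 3 + E * (\<rho> * real t)\<^sup>2 * (F x)\<^sup>2" by (simp add: E_def)
      finally show ?thesis .
    next
      case False
      then have "1 \<le> (\<rho> * real t) * F x" using \<rho> t by (simp add: field_simps)
      then have "1 \<le> ((\<rho> * real t) * F x)\<^sup>2" by (simp add: one_le_power)
      then have E1: "E * 1 \<le> E * ((\<rho> * real t) * F x)\<^sup>2"
        by (intro mult_left_mono) (auto simp: E_def)
      have "(\<Sum>T\<in>tuples t \<Phi>. (\<Prod>s<t. \<nu> (T s)) * min (dual_tilt \<rho> t T x) E) \<le>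
          (\<Sum>T\<in>tuples t \<Phi>. (\<Prod>s<t. \<nu> (T s)) * E)"
        using nu0 by (intro sum_mono mult_left_mono prod_nonneg) auto
      also have "\<dots> = E" using nuT by (simp add: sum_distrib_right[symmetric])
      finally show ?thesis using E1 by (simp add: power_mult_distrib mult_ac)
    qed
    finally show ?thesis by simp
  qed
  have "(\<Sum>T\<in>tuples t \<Phi>. (\<Prod>s<t. \<nu> (T s)) * mean X (clipped_tilt \<rho> t T)) =
      mean X (\<lambda>x. \<Sum>T\<in>tuples t \<Phi>. (\<Prod>s<t. \<nu> (T s)) * clipped_tilt \<rho> t T x)"
    by (simp only: mean_sum mean_cmult)
  also have "\<dots> \<le> mean X (\<lambda>x. 4 + E * (\<rho> * real t)\<^sup>2 * (F x)\<^sup>2)"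
    by (intro mean_mono pt)
  also have "\<dots> = 4 + E * (\<rho> * real t)\<^sup>2 * mean X (\<lambda>x. (F x)\<^sup>2)"
    by (simp only: mean_add mean_cmult mean_const[OF finite_X X_ne])
  also have "\<dots> \<le> 4 + E * (\<rho> * real t)\<^sup>2 * (1200 * (1 + \<rho>\<^sup>2) ^ k / real (card Y))"
    unfolding F_def \<nu>_def
    by (intro add_left_mono mult_left_mono mean_posterior_fourier_square) (auto simp: E_def)
  also have "\<dots> \<le> 5"
    using big card_Y_pos by (simp add: E_def power_mult_distrib mult_ac)
  finally show ?thesis by (simp add: \<nu>_def)
qed

text \<open>Two applications of Markov leave half of the posterior samples \<open>T\<close> with
  total squared deviation at most \<open>88 * t\<^sup>2\<close> and mean clipped tilt at most 20.
  For these the likelihood of \<open>T\<close> exceeds the clipped product by at most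
  \<open>exp (88 * t\<^sup>2 / (4 * t)) = exp (22 * t)\<close>. On the right \<open>S\<close> enters
  only through a product over its coordinates, and the range of \<open>T\<close> does not depend on
  \<open>S\<close>, so averaging over \<open>S\<close> becomes possible.\<close>

lemma typical_tuple_weight:
  assumes t: "1 \<le> t" "k \<le> t"
    and big: "1200 * (1 + \<rho>\<^sup>2) ^ k * \<rho>\<^sup>2 * (real t)\<^sup>2 * exp (2 * \<rho>\<^sup>2 * real t) \<le> real (card Y)"
  shows "(3/10 * real (card Y)) ^ t / 2 \<le>
    exp (22 * real t) * (\<Sum>T\<in>{T\<in>tuples t \<Phi>. mean X (clipped_tilt \<rho> t T) \<le> 20}. \<Prod>i<k. clipped_tilt \<rho> t T (S i))"
proof -
  define \<nu> where "\<nu> = posterior \<rho> k S \<Phi>"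
  define d where "d T = (\<Sum>i<k. (\<Sum>s<t. \<xi> (S i) (T s) - \<rho>)\<^sup>2)" for T
  define c where "c T = mean X (clipped_tilt \<rho> t T)" for T
  define \<sigma> where "\<sigma> = (\<Sum>y\<in>\<Phi>. tilt \<rho> k S y)"
  define p where "p T = (\<Prod>s<t. \<nu> (T s))" for T
  let ?P = "tuples t \<Phi>"
  have fin: "finite \<Phi>" using sub finite_Y by (rule finite_subset)
  have finP: "finite ?P" using fin by (rule finite_tuples)
  have p0: "0 \<le> p T" for T
    unfolding p_def \<nu>_def using \<rho> by (intro prod_nonneg) (simp add: posterior_nonneg)
  have d0: "0 \<le> d T" for T by (simp add: d_def sum_nonneg)
  have c0: "0 \<le> c T" for T unfolding c_def by (rule mean_nonneg) (simp add: clipped_tilt_def)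
  have tp: "0 < real t" using t by simp
  have "(\<Sum>T\<in>?P. p T) = 1"
    unfolding p_def using sum_tuples_prod[OF fin, where q=\<nu> and k=t] sum_posterior by (simp add: \<nu>_def)
  moreover have "(\<Sum>T\<in>?P. p T * of_bool (88 * (real t)\<^sup>2 < d T)) \<le> 1/4"
  proof -
    have "(\<Sum>T\<in>?P. p T * of_bool (88 * (real t)\<^sup>2 < d T)) \<le> (\<Sum>T\<in>?P. p T * d T) / (88 * (real t)\<^sup>2)"
      using p0 d0 tp by (intro sum_markov) auto
    also have "\<dots> \<le> 22 * (real t)\<^sup>2 / (88 * (real t)\<^sup>2)"
      using posterior_sample_deviation[OF t(2)] by (intro divide_right_mono) (auto simp: p_def d_def \<nu>_def)
    finally show ?thesis using tp by simp
  qed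
  moreover have "(\<Sum>T\<in>?P. p T * of_bool (20 < c T)) \<le> 1/4"
  proof -
    have "(\<Sum>T\<in>?P. p T * of_bool (20 < c T)) \<le> (\<Sum>T\<in>?P. p T * c T) / 20"
      using p0 c0 by (intro sum_markov) auto
    also have "\<dots> \<le> 5 / 20"
      using posterior_sample_clipped_tilt[OF t(1) big] by (intro divide_right_mono) (auto simp: p_def c_def \<nu>_def)
    finally show ?thesis by simp
  qed
  moreover have "(\<Sum>T\<in>?P. p T) \<le> (\<Sum>T\<in>?P. p T * of_bool (c T \<le> 20 \<and> d T \<le> 88 * (real t)\<^sup>2) +
      (p T * of_bool (88 * (real t)\<^sup>2 < d T) + p T * of_bool (20 < c T)))"
    using p0 by (intro sum_mono) (auto simp: of_bool_def)
  ultimately have half: "1/2 \<le> (\<Sum>T\<in>?P. p T * of_bool (c T \<le> 20 \<and> d T \<le> 88 * (real t)\<^sup>2))"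
    by (simp add: sum.distrib)
  have "p T * of_bool (c T \<le> 20 \<and> d T \<le> 88 * (real t)\<^sup>2) \<le>
      of_bool (c T \<le> 20) * (exp (22 * real t) * (\<Prod>i<k. clipped_tilt \<rho> t T (S i)) / \<sigma> ^ t)" for T
  proof (cases "c T \<le> 20 \<and> d T \<le> 88 * (real t)\<^sup>2")
    case True
    have "p T = (\<Prod>i<k. dual_tilt \<rho> t T (S i)) / \<sigma> ^ t"
      by (simp add: p_def \<nu>_def posterior_def prod_dividef \<sigma>_def[symmetric] prod_tilt_eq_prod_dual_tilt)
    moreover have "(\<Prod>i<k. dual_tilt \<rho> t T (S i)) \<le>
        (\<Prod>i<k. clipped_tilt \<rho> t T (S i) * exp ((\<Sum>s<t. \<xi> (S i) (T s) - \<rho>)\<^sup>2 / (4 * real t)))"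
      using \<rho> t by (intro prod_mono conjI dual_tilt_nonneg dual_tilt_le_clipped_tilt) auto
    moreover have "\<dots> = (\<Prod>i<k. clipped_tilt \<rho> t T (S i)) * exp (d T / (4 * real t))"
      by (simp add: prod.distrib exp_sum[symmetric] d_def sum_divide_distrib)
    moreover have "\<dots> \<le> (\<Prod>i<k. clipped_tilt \<rho> t T (S i)) * exp (22 * real t)"
    proof (intro mult_left_mono prod_nonneg)
      have "d T / (4 * real t) \<le> 88 * (real t)\<^sup>2 / (4 * real t)"
        using True tp by (intro divide_right_mono) auto
      then show "exp (d T / (4 * real t)) \<le> exp (22 * real t)"
        using tp by (simp add: power2_eq_square)
    qed (auto simp: clipped_tilt_def)
    ultimately have "p T \<le> (\<Prod>i<k. clipped_tilt \<rho> t T (S i)) * exp (22 * real t) / \<sigma> ^ t"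
      using tilt_sum_pos by (simp add: divide_right_mono \<sigma>_def)
    then show ?thesis using True by (simp add: mult_ac)
  next
    case False
    have "0 \<le> of_bool (c T \<le> 20) * (exp (22 * real t) * (\<Prod>i<k. clipped_tilt \<rho> t T (S i)) / \<sigma> ^ t)"
      using tilt_sum_pos by (intro mult_nonneg_nonneg divide_nonneg_nonneg prod_nonneg)
        (auto simp: clipped_tilt_def \<sigma>_def)
    then show ?thesis using False by auto
  qed
  then have "1/2 \<le> (\<Sum>T\<in>?P. of_bool (c T \<le> 20) * (exp (22 * real t) * (\<Prod>i<k. clipped_tilt \<rho> t T (S i)) / \<sigma> ^ t))"
    by (intro order_trans[OF half] sum_mono)
  also have "\<dots> = (\<Sum>T\<in>{T\<in>?P. c T \<le> 20}. exp (22 * real t) * (\<Prod>i<k. clipped_tilt \<rho> t T (S i)) / \<sigma> ^ t)"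
    using finP by (intro sum.mono_neutral_cong_right) auto
  also have "\<dots> = exp (22 * real t) * (\<Sum>T\<in>{T\<in>?P. c T \<le> 20}. \<Prod>i<k. clipped_tilt \<rho> t T (S i)) / \<sigma> ^ t"
    by (simp add: sum_distrib_left sum_divide_distrib)
  finally have "\<sigma> ^ t / 2 \<le> exp (22 * real t) * (\<Sum>T\<in>{T\<in>?P. c T \<le> 20}. \<Prod>i<k. clipped_tilt \<rho> t T (S i))"
    using tilt_sum_pos by (simp add: \<sigma>_def pos_le_divide_eq)
  moreover have "(3/10 * real (card Y)) ^ t \<le> \<sigma> ^ t"
    using heavy by (intro power_mono) (auto simp: \<sigma>_def)
  ultimately show ?thesis by (simp add: c_def)
qed

end

section \<open>Counting the tuples served by one set, and the union bound over messages\<close>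

lemma mean_heavy_typical_le:
  assumes \<rho>: "0 < \<rho>" "\<rho> \<le> 1" and t: "1 \<le> t" "k \<le> t" and sub: "\<Phi> \<subseteq> Y"
    and big: "1200 * (1 + \<rho>\<^sup>2) ^ k * \<rho>\<^sup>2 * (real t)\<^sup>2 * exp (2 * \<rho>\<^sup>2 * real t) \<le> real (card Y)"
    and small: "real (card \<Phi>) \<le> \<tau> * real (card Y)"
  shows "mean (tuples k X) (\<lambda>S. of_bool (typical \<rho> k S \<and> 3/10 * real (card Y) \<le> (\<Sum>y\<in>\<Phi>. tilt \<rho> k S y)))
    \<le> 2 * (exp 24 * \<tau>) ^ t * 20 ^ k"
proof -
  define G where "G S \<longleftrightarrow> typical \<rho> k S \<and> 3/10 * real (card Y) \<le> (\<Sum>y\<in>\<Phi>. tilt \<rho> k S y)" for S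
  define Q where "Q = {T\<in>tuples t \<Phi>. mean X (clipped_tilt \<rho> t T) \<le> 20}"
  define D where "D = real (card Y)"
  have D: "0 < D" using card_Y_pos by (simp add: D_def)
  have fin: "finite \<Phi>" using sub finite_Y by (rule finite_subset)
  have "(3/10 * D) ^ t / 2 * of_bool (G S) \<le>
      exp (22 * real t) * (\<Sum>T\<in>Q. \<Prod>i<k. clipped_tilt \<rho> t T (S i))" for S
  proof (cases "G S")
    case True
    then show ?thesis
      using typical_tuple_weight[OF \<rho> _ sub _ t big] by (auto simp: G_def Q_def D_def)
  next
    case False
    have "0 \<le> exp (22 * real t) * (\<Sum>T\<in>Q. \<Prod>i<k. clipped_tilt \<rho> t T (S i))"
      by (intro mult_nonneg_nonneg sum_nonneg prod_nonneg) (auto simp: clipped_tilt_def)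
    then show ?thesis using False by simp
  qed
  then have "mean (tuples k X) (\<lambda>S. (3/10 * D) ^ t / 2 * of_bool (G S)) \<le>
      mean (tuples k X) (\<lambda>S. exp (22 * real t) * (\<Sum>T\<in>Q. \<Prod>i<k. clipped_tilt \<rho> t T (S i)))"
    by (intro mean_mono)
  \<comment> \<open>For fixed \<open>T\<close> the mean over tuples factorises into a
    \<open>k\<close>-th power, which the restriction defining \<open>Q\<close> bounds by
    \<open>20 ^ k\<close>.\<close>
  then have "(3/10 * D) ^ t / 2 * mean (tuples k X) (\<lambda>S. of_bool (G S)) \<le>
      exp (22 * real t) * (\<Sum>T\<in>Q. mean X (clipped_tilt \<rho> t T) ^ k)"
    by (simp only: mean_cmult mean_sum mean_tuples_prod[OF finite_X])
  also have "\<dots> \<le> exp (22 * real t) * (\<Sum>T\<in>Q. 20 ^ k)"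
    by (intro mult_left_mono sum_mono power_mono mean_nonneg) (auto simp: Q_def clipped_tilt_def)
  also have "\<dots> \<le> exp (22 * real t) * ((\<tau> * D) ^ t * 20 ^ k)"
  proof -
    have "card Q \<le> card (tuples t \<Phi>)"
      unfolding Q_def by (intro card_mono finite_tuples fin) auto
    then have "real (card Q) \<le> real (card \<Phi>) ^ t"
      using card_tuples[OF fin, of t] by (metis of_nat_le_iff of_nat_power)
    also have "\<dots> \<le> (\<tau> * D) ^ t" using small by (intro power_mono) (auto simp: D_def)
    finally have "real (card Q) \<le> (\<tau> * D) ^ t" .
    then show ?thesis by simp
  qed
  also have "\<dots> = exp 22 ^ t * \<tau> ^ t * 20 ^ k * D ^ t"
    by (simp add: exp_of_nat_mult[symmetric] power_mult_distrib mult_ac)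
  finally have "(3/10) ^ t / 2 * mean (tuples k X) (\<lambda>S. of_bool (G S)) * D ^ t \<le> exp 22 ^ t * \<tau> ^ t * 20 ^ k * D ^ t"
    by (simp only: power_mult_distrib) (simp add: mult_ac)
  then have "(3/10) ^ t / 2 * mean (tuples k X) (\<lambda>S. of_bool (G S)) \<le> exp 22 ^ t * \<tau> ^ t * 20 ^ k"
    using D by simp
  then have "mean (tuples k X) (\<lambda>S. of_bool (G S)) \<le> 2 * (10/3) ^ t * (exp 22 ^ t * \<tau> ^ t * 20 ^ k)"
    by (simp add: field_simps)
  also have "\<dots> = 2 * (10/3 * exp 22 * \<tau>) ^ t * 20 ^ k" by (simp only: power_mult_distrib mult.assoc)
  also have "\<dots> \<le> 2 * (exp 24 * \<tau>) ^ t * 20 ^ k"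
  proof -
    have \<tau>: "0 \<le> \<tau>" using small D by (metis D_def of_nat_0_le_iff order_trans zero_le_mult_iff not_less)
    \<comment> \<open>Normalising by the weight of the heavy set costs \<open>10/3\<close> per
      sample; raising \<open>exp 22\<close> to \<open>exp 24\<close> absorbs it.\<close>
    have "(10/3::real) \<le> (1 + 1) * (1 + 1)" by simp
    also have "\<dots> \<le> exp 1 * exp 1" by (intro mult_mono exp_ge_add_one_self) auto
    also have "\<dots> = exp 2" by (simp add: exp_add[symmetric])
    finally have "10/3 * exp 22 \<le> exp 2 * exp (22::real)" by (intro mult_right_mono) auto
    also have "\<dots> = exp 24" by (simp add: exp_add[symmetric])
    finally have "10/3 * exp 22 * \<tau> \<le> exp 24 * \<tau>" using \<tau> by (intro mult_right_mono)
    then have "(10/3 * exp 22 * \<tau>) ^ t \<le> (exp 24 * \<tau>) ^ t" using \<tau> by (intro power_mono) auto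
    then show ?thesis by simp
  qed
  finally show ?thesis by (simp add: G_def)
qed

text \<open>A typical tuple has tilted mass at least \<open>9/10\<close>; if its set misses at most
  \<open>3/5\<close>, the set keeps \<open>3/10\<close> and is heavy. So every typical successful
  tuple is counted for its own message, and atypical ones cost at most \<open>3/100\<close> of the
  \<open>1/10\<close>.\<close>

lemma encoding_bound:
  assumes \<rho>: "0 < \<rho>" "\<rho> \<le> 1" and k: "1 \<le> k" and t: "k \<le> t" and M: "finite M"
    and enc: "\<And>S. S \<in> tuples k X \<Longrightarrow> enc S \<in> M"
    and sub: "\<And>m. \<Phi> m \<subseteq> Y"
    and big: "1200 * (1 + \<rho>\<^sup>2) ^ k * \<rho>\<^sup>2 * (real t)\<^sup>2 * exp (2 * \<rho>\<^sup>2 * real t) \<le> real (card Y)"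
    and big': "10000 * (real k)\<^sup>2 * (1 + \<rho>\<^sup>2) ^ k \<le> real (card Y)"
    and succ: "1/10 \<le> mean (tuples k X) (\<lambda>S. of_bool (real (card (\<Phi> (enc S))) \<le> \<tau> * real (card Y) \<and>
                 mean Y (\<lambda>y. tilt \<rho> k S y * of_bool (y \<notin> \<Phi> (enc S))) \<le> 3/5))"
    and \<tau>: "0 \<le> \<tau>"
  shows "1/20 \<le> real (card M) * (2 * (exp 24 * \<tau>) ^ t * 20 ^ k)"
proof -
  define M' where "M' = {m\<in>M. real (card (\<Phi> m)) \<le> \<tau> * real (card Y)}"
  define G where "G m S \<longleftrightarrow> typical \<rho> k S \<and> 3/10 * real (card Y) \<le> (\<Sum>y\<in>\<Phi> m. tilt \<rho> k S y)" for m S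
  define Q where "Q S \<longleftrightarrow> real (card (\<Phi> (enc S))) \<le> \<tau> * real (card Y) \<and>
                 mean Y (\<lambda>y. tilt \<rho> k S y * of_bool (y \<notin> \<Phi> (enc S))) \<le> 3/5" for S
  have step: "of_bool (Q S) \<le> of_bool (\<not> typical \<rho> k S) + (\<Sum>m\<in>M'. of_bool (G m S) :: real)"
    if S: "S \<in> tuples k X" for S
  proof (cases "Q S \<and> typical \<rho> k S")
    case True
    have "mass \<rho> k S = mean Y (\<lambda>y. tilt \<rho> k S y * of_bool (y \<in> \<Phi> (enc S)) + tilt \<rho> k S y * of_bool (y \<notin> \<Phi> (enc S)))"
      unfolding mass_def by (rule mean_cong) auto
    then have "9/10 - 3/5 \<le> mean Y (\<lambda>y. tilt \<rho> k S y * of_bool (y \<in> \<Phi> (enc S)))"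
      using True unfolding mean_add Q_def typical_def abs_le_iff by linarith
    also have "(\<Sum>y\<in>Y. tilt \<rho> k S y * of_bool (y \<in> \<Phi> (enc S))) = (\<Sum>y\<in>\<Phi> (enc S). tilt \<rho> k S y)"
      using finite_Y sub by (intro sum.mono_neutral_cong_right) auto
    then have "mean Y (\<lambda>y. tilt \<rho> k S y * of_bool (y \<in> \<Phi> (enc S))) = (\<Sum>y\<in>\<Phi> (enc S). tilt \<rho> k S y) / card Y"
      by (simp add: mean_def)
    finally have "G (enc S) S"
      using True card_Y_pos by (simp add: G_def pos_le_divide_eq)
    moreover have "enc S \<in> M'" using enc[OF S] True by (simp add: M'_def Q_def)
    ultimately have "(1::real) \<le> (\<Sum>m\<in>M'. of_bool (G m S))"
      using M member_le_sum[of "enc S" M' "\<lambda>m. of_bool (G m S) :: real"] by (simp add: M'_def)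
    then show ?thesis using True by simp
  next
    case False
    have "0 \<le> (\<Sum>m\<in>M'. of_bool (G m S) :: real)" by (intro sum_nonneg) auto
    then show ?thesis using False by auto
  qed
  have "1/10 \<le> mean (tuples k X) (\<lambda>S. of_bool (Q S))" using succ by (simp add: Q_def)
  also have "\<dots> \<le> mean (tuples k X) (\<lambda>S. of_bool (\<not> typical \<rho> k S) + (\<Sum>m\<in>M'. of_bool (G m S)))"
    by (intro mean_mono step)
  also have "\<dots> = mean (tuples k X) (\<lambda>S. of_bool (\<not> typical \<rho> k S)) + (\<Sum>m\<in>M'. mean (tuples k X) (\<lambda>S. of_bool (G m S)))"
    by (simp add: mean_add mean_sum)
  also have "\<dots> \<le> 3/100 + (\<Sum>m\<in>M'. 2 * (exp 24 * \<tau>) ^ t * 20 ^ k)"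
    unfolding G_def using \<rho> k t big big' sub
    by (intro add_mono sum_mono mean_not_typical mean_heavy_typical_le) (auto simp: M'_def)
  also have "\<dots> \<le> 3/100 + real (card M) * (2 * (exp 24 * \<tau>) ^ t * 20 ^ k)"
    using M \<tau> by (auto intro!: mult_right_mono card_mono simp: M'_def)
  finally show ?thesis by simp
qed

end

section \<open>Concentration of the sample mean under the uniform and the tilted law\<close>

lemma exp_le_one_plus_square:
  fixes x :: real
  assumes "\<bar>x\<bar> \<le> 1"
  shows "exp x \<le> 1 + x + x\<^sup>2"
proof (cases "0 \<le> x")
  case True
  then show ?thesis using assms exp_bound[of x] by simp
next
  case False
  define z where "z = - x"
  have z: "0 < z" using False by (simp add: z_def)
  \<comment> \<open>The product equals \<open>1 + z ^ 3\<close>.\<close>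
  have "1 \<le> (1 + z) * (1 - z + z\<^sup>2)"
    using z by (simp add: algebra_simps power2_eq_square)
  also have "\<dots> \<le> exp z * (1 - z + z\<^sup>2)"
  proof (rule mult_right_mono[OF exp_ge_add_one_self])
    have "0 \<le> (z - 1/2)\<^sup>2" by simp
    then show "0 \<le> 1 - z + z\<^sup>2" by (simp add: power2_eq_square algebra_simps)
  qed
  finally have "1 / exp z \<le> 1 - z + z\<^sup>2" by (simp add: field_simps)
  then show ?thesis by (simp add: z_def exp_minus inverse_eq_divide)
qed

context sign_matrix
begin

definition sample_mean :: "nat \<Rightarrow> (nat \<Rightarrow> 'a) \<Rightarrow> 'b \<Rightarrow> real" where
  "sample_mean k S y = (\<Sum>i<k. \<xi> (S i) y) / real k"

lemma sample_mean_tail: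
  assumes "y \<in> Y" "0 \<le> \<kappa>" "\<kappa> \<le> 1" "1 \<le> k"
  shows "mean (tuples k X) (\<lambda>S. of_bool (\<kappa> \<le> sample_mean k S y)) \<le> exp (- \<kappa>\<^sup>2 * real k / 4)"
proof -
  \<comment> \<open>This value minimises the exponent \<open>l\<^sup>2 - l * \<kappa>\<close> per
    coordinate, giving \<open>- \<kappa>\<^sup>2 / 4\<close>.\<close>
  define l where "l = \<kappa> / 2"
  have "mean (tuples k X) (\<lambda>S. of_bool (\<kappa> \<le> sample_mean k S y)) \<le>
      mean (tuples k X) (\<lambda>S. exp (- l * \<kappa> * real k) * (\<Prod>i<k. exp (l * \<xi> (S i) y)))"
  proof (rule mean_mono)
    fix S
    have "of_bool (\<kappa> \<le> sample_mean k S y) \<le> exp (l * (\<Sum>i<k. \<xi> (S i) y) - l * \<kappa> * real k)"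
    proof (cases "\<kappa> \<le> sample_mean k S y")
      case True
      then have "\<kappa> * real k \<le> (\<Sum>i<k. \<xi> (S i) y)"
        using assms by (simp add: sample_mean_def pos_le_divide_eq)
      then have "l * (\<kappa> * real k) \<le> l * (\<Sum>i<k. \<xi> (S i) y)"
        using assms by (intro mult_left_mono) (auto simp: l_def)
      then show ?thesis using True by simp
    qed simp
    also have "\<dots> = exp (- l * \<kappa> * real k) * (\<Prod>i<k. exp (l * \<xi> (S i) y))"
      by (simp add: exp_diff exp_minus sum_distrib_left exp_sum field_simps)
    finally show "of_bool (\<kappa> \<le> sample_mean k S y) \<le> exp (- l * \<kappa> * real k) * (\<Prod>i<k. exp (l * \<xi> (S i) y))" .
  qed
  also have "\<dots> = exp (- l * \<kappa> * real k) * mean X (\<lambda>x. exp (l * \<xi> x y)) ^ k"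
    by (simp only: mean_cmult mean_tuples_prod[OF finite_X, of k "\<lambda>x. exp (l * \<xi> x y)"])
  also have "\<dots> \<le> exp (- l * \<kappa> * real k) * exp (l\<^sup>2) ^ k"
  proof (intro mult_left_mono power_mono mean_nonneg)
    have "mean X (\<lambda>x. exp (l * \<xi> x y)) \<le> mean X (\<lambda>x. 1 + (l * \<xi> x y + l\<^sup>2))"
    proof (rule mean_mono)
      fix x
      have "\<bar>l * \<xi> x y\<bar> \<le> 1" using assms by (simp add: abs_mult abs_sign l_def)
      then have "exp (l * \<xi> x y) \<le> 1 + l * \<xi> x y + (l * \<xi> x y)\<^sup>2" by (rule exp_le_one_plus_square)
      then show "exp (l * \<xi> x y) \<le> 1 + (l * \<xi> x y + l\<^sup>2)"
        using sign_cases[of x y] by auto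
    qed
    also have "\<dots> = 1 + l\<^sup>2"
      using assms by (simp only: mean_add mean_cmult mean_sign mean_const[OF finite_X X_ne])
    also have "\<dots> \<le> exp (l\<^sup>2)" by (rule exp_ge_add_one_self)
    finally show "mean X (\<lambda>x. exp (l * \<xi> x y)) \<le> exp (l\<^sup>2)" .
  qed auto
  also have "\<dots> = exp (- l * \<kappa> * real k + real k * l\<^sup>2)"
    by (simp only: exp_of_nat_mult[symmetric] exp_add)
  also have "- l * \<kappa> * real k + real k * l\<^sup>2 = - \<kappa>\<^sup>2 * real k / 4"
    by (simp add: l_def power2_eq_square)
  finally show ?thesis .
qed

lemma tilted_sample_mean_deviation:
  assumes y: "y \<in> Y" and \<rho>: "0 \<le> \<rho>" "\<rho> \<le> 1" and \<kappa>: "0 < \<kappa>" and k: "1 \<le> k"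
  shows "mean (tuples k X) (\<lambda>S. tilt \<rho> k S y * of_bool (\<kappa> < \<bar>sample_mean k S y - \<rho>\<bar>)) \<le> 1 / (real k * \<kappa>\<^sup>2)"
proof -
  define N where "N = real (card X)"
  have N: "0 < N" using finite_X X_ne by (simp add: N_def card_gt_0_iff)
  \<comment> \<open>The tilt is the density of \<open>k\<close> independent draws from
    \<open>q\<close>, a law under which the sign has mean \<open>\<rho>\<close> and variance
    \<open>1 - \<rho>\<^sup>2\<close>. The rest is Chebyshev.\<close>
  define q where "q x = (1 + \<rho> * \<xi> x y) / N" for x
  have q1: "(\<Sum>x\<in>X. q x) = 1"
    using mean_tilt_factor[OF y, of \<rho>] by (simp add: q_def mean_def sum_divide_distrib[symmetric] N_def)
  have qh: "q x * (\<xi> x y - \<rho>) = (1 - \<rho>\<^sup>2) / N * \<xi> x y" for x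
    using sign_cases[of x y] N by (auto simp: q_def field_simps power2_eq_square)
  have sx: "(\<Sum>x\<in>X. \<xi> x y) = 0" using mean_sign[OF y] finite_X X_ne by (simp add: mean_def)
  have q2: "(\<Sum>x\<in>X. q x * (\<xi> x y - \<rho>)) = 0"
    unfolding qh sum_distrib_left[symmetric] sx by simp
  have "q x * (\<xi> x y - \<rho>)\<^sup>2 = (1 - \<rho>\<^sup>2) / N * (1 - \<rho> * \<xi> x y)" for x
    using sign_cases[of x y] N by (auto simp: q_def field_simps power2_eq_square)
  then have "(\<Sum>x\<in>X. q x * (\<xi> x y - \<rho>)\<^sup>2) = (1 - \<rho>\<^sup>2) / N * (\<Sum>x\<in>X. 1 - \<rho> * \<xi> x y)"
    by (simp only: sum_distrib_left)
  also have "(\<Sum>x\<in>X. 1 - \<rho> * \<xi> x y) = N"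
    using sx by (simp add: sum_subtractf sum_distrib_left[symmetric] N_def)
  finally have q3: "(\<Sum>x\<in>X. q x * (\<xi> x y - \<rho>)\<^sup>2) = 1 - \<rho>\<^sup>2" using N by simp
  have dev: "(\<Sum>i<k. \<xi> (S i) y - \<rho>) = real k * (sample_mean k S y - \<rho>)" for S
    using k by (simp add: sample_mean_def sum_subtractf field_simps)
  have "mean (tuples k X) (\<lambda>S. tilt \<rho> k S y * of_bool (\<kappa> < \<bar>sample_mean k S y - \<rho>\<bar>)) \<le>
      mean (tuples k X) (\<lambda>S. 1 / (real k * \<kappa>)\<^sup>2 * (tilt \<rho> k S y * (\<Sum>i<k. \<xi> (S i) y - \<rho>)\<^sup>2))"
  proof (rule mean_mono)
    fix S
    have "of_bool (\<kappa> < \<bar>sample_mean k S y - \<rho>\<bar>) \<le> (real k * (sample_mean k S y - \<rho>))\<^sup>2 / (real k * \<kappa>)\<^sup>2"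
    proof (cases "\<kappa> < \<bar>sample_mean k S y - \<rho>\<bar>")
      case True
      then have "\<kappa>\<^sup>2 \<le> (sample_mean k S y - \<rho>)\<^sup>2"
        using \<kappa> by (metis abs_le_square_iff abs_of_pos less_imp_le)
      then show ?thesis using True k \<kappa> by (simp add: power_mult_distrib divide_simps)
    qed simp
    then have "tilt \<rho> k S y * of_bool (\<kappa> < \<bar>sample_mean k S y - \<rho>\<bar>) \<le>
        tilt \<rho> k S y * ((real k * (sample_mean k S y - \<rho>))\<^sup>2 / (real k * \<kappa>)\<^sup>2)"
      using \<rho> by (intro mult_left_mono tilt_nonneg)
    then show "tilt \<rho> k S y * of_bool (\<kappa> < \<bar>sample_mean k S y - \<rho>\<bar>) \<le>
        1 / (real k * \<kappa>)\<^sup>2 * (tilt \<rho> k S y * (\<Sum>i<k. \<xi> (S i) y - \<rho>)\<^sup>2)"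
      unfolding dev by simp
  qed
  also have "\<dots> = 1 / (real k * \<kappa>)\<^sup>2 * (\<Sum>S\<in>tuples k X. (\<Prod>l<k. q (S l)) * (\<Sum>i<k. \<xi> (S i) y - \<rho>)\<^sup>2)"
    by (simp only: mean_cmult) (simp add: mean_def card_tuples[OF finite_X] q_def prod_dividef tilt_def
        N_def[symmetric] sum_divide_distrib)
  also have "\<dots> = 1 / (real k * \<kappa>)\<^sup>2 * (real k * (1 - \<rho>\<^sup>2))"
    by (simp only: sum_tuples_second_moment[OF finite_X q1, of k "\<lambda>x. \<xi> x y - \<rho>"] q2 q3) simp
  also have "\<dots> \<le> 1 / (real k * \<kappa>)\<^sup>2 * (real k * 1)"
    by (intro mult_left_mono) auto
  also have "\<dots> = 1 / (real k * \<kappa>\<^sup>2)" using k by (simp add: power2_eq_square)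
  finally show ?thesis .
qed

end

section \<open>Characters of the cube\<close>

lemma cube_eq: "cube n = {x. set x \<subseteq> UNIV \<and> length x = n}"
  by (simp add: cube_def)

lemma UNIV_bit: "(UNIV :: bit set) = {0, 1}"
  by (auto intro: bit.exhaust)

lemma finite_cube: "finite (cube n)" and card_cube: "card (cube n) = 2 ^ n"
  unfolding cube_eq using finite_lists_length_eq[of "UNIV :: bit set" n] card_lists_length_eq[of "UNIV :: bit set" n]
  by (simp_all add: UNIV_bit numeral_2_eq_2)

lemma inner_F2_flip:
  assumes "i < n" "length x = n"
  shows "inner_F2 n (x[i := x ! i + 1]) y = inner_F2 n x y + y ! i"
proof -
  have "inner_F2 n (x[i := x ! i + 1]) y = (x ! i + 1) * y ! i + (\<Sum>j\<in>{..<n} - {i}. x ! j * y ! j)"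
    unfolding inner_F2_def using assms by (subst sum.remove[of _ i]) (auto intro!: sum.cong)
  also have "\<dots> = inner_F2 n x y + y ! i"
    unfolding inner_F2_def using assms by (subst (2) sum.remove[of _ i]) (auto simp: algebra_simps)
  finally show ?thesis .
qed

lemma ip_sign_flip:
  assumes "i < n" "length x = n"
  shows "ip_sign n (x[i := x ! i + 1]) y = (if y ! i = 0 then 1 else - 1) * ip_sign n x y"
  using inner_F2_flip[OF assms, of y] by (cases "inner_F2 n x y"; cases "y ! i") (auto simp: ip_sign_def)

lemma sum_cube_eq_0:
  fixes f :: "bit list \<Rightarrow> real"
  assumes "i < n" "\<And>x. x \<in> cube n \<Longrightarrow> f (x[i := x ! i + 1]) = - f x"
  shows "(\<Sum>x\<in>cube n. f x) = 0"
proof -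
  have "bij_betw (\<lambda>x. x[i := x ! i + 1]) (cube n) (cube n)"
    by (rule bij_betwI[where g = "\<lambda>x. x[i := x ! i + 1]"])
      (use assms(1) in \<open>auto simp: cube_def list_update_same_conv\<close>)
  then have "(\<Sum>x\<in>cube n. f x) = (\<Sum>x\<in>cube n. f (x[i := x ! i + 1]))"
    by (rule sum.reindex_bij_betw[symmetric])
  also have "\<dots> = - (\<Sum>x\<in>cube n. f x)" using assms(2) by (simp add: sum_negf)
  finally show ?thesis by simp
qed

text \<open>At the zero vector the sign is constantly 1 instead of having mean 0.\<close>

definition nonzero_cube :: "nat \<Rightarrow> bit list set" where
  "nonzero_cube n = cube n - {replicate n 0}"

lemma card_nonzero_cube: "card (nonzero_cube n) = 2 ^ n - 1"
  by (simp add: nonzero_cube_def card_Diff_singleton cube_def[of n] card_cube[unfolded cube_def])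

text \<open>Flipping a coordinate where \<open>y\<close> is nonzero negates the sign; flipping one
  where \<open>y\<close> and \<open>y'\<close> differ negates the product.\<close>

lemma ip_sign_matrix:
  assumes "1 \<le> n"
  shows "sign_matrix (cube n) (nonzero_cube n) (ip_sign n)"
proof
  show "finite (cube n)" by (rule finite_cube)
  show "cube n \<noteq> {}" using card_cube[of n] by (metis card.empty power_not_zero zero_neq_numeral)
  show "finite (nonzero_cube n)" by (simp add: nonzero_cube_def finite_cube)
  have "(2::nat) ^ 1 \<le> 2 ^ n" using assms by (intro power_increasing) auto
  then show "nonzero_cube n \<noteq> {}" using card_nonzero_cube[of n] by (metis card.empty
        not_numeral_le_zero diff_is_0_eq power_one_right one_le_numeral numeral_le_one_iff le_trans semiring_norm(69))
  show "ip_sign n x y * ip_sign n x y = 1" for x y by (simp add: ip_sign_def)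
  show "mean (cube n) (\<lambda>x. ip_sign n x y) = 0" if y: "y \<in> nonzero_cube n" for y
  proof -
    obtain i where "i < n" "y ! i \<noteq> 0"
      using y by (auto simp: nonzero_cube_def cube_def list_eq_iff_nth_eq)
    then have "(\<Sum>x\<in>cube n. ip_sign n x y) = 0"
      by (intro sum_cube_eq_0[of i]) (auto simp only: cube_def mem_Collect_eq ip_sign_flip if_False mult_minus1)
    then show ?thesis by (simp add: mean_def)
  qed
  show "mean (cube n) (\<lambda>x. ip_sign n x y * ip_sign n x y') = 0"
    if y: "y \<in> nonzero_cube n" "y' \<in> nonzero_cube n" "y \<noteq> y'" for y y'
  proof -
    obtain i where i: "i < n" "y ! i \<noteq> y' ! i"
      using y by (auto simp: nonzero_cube_def cube_def list_eq_iff_nth_eq)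
    then have "(if y ! i = 0 then 1 else - 1) * (if y' ! i = 0 then 1 else - 1) = (-1::real)"
      by (cases "y ! i"; cases "y' ! i") auto
    then have "ip_sign n (x[i := x ! i + 1]) y * ip_sign n (x[i := x ! i + 1]) y' = - (ip_sign n x y * ip_sign n x y')"
      if "x \<in> cube n" for x
      using i that by (simp only: cube_def mem_Collect_eq ip_sign_flip) (auto split: if_splits)
    then have "(\<Sum>x\<in>cube n. ip_sign n x y * ip_sign n x y') = 0"
      using i by (intro sum_cube_eq_0[of i])
    then show ?thesis by (simp add: mean_def)
  qed
qed

section \<open>Protocols\<close>

text \<open>Pushing forward the law of the index counts repeated points with multiplicity, so the
  target is exactly the average over all \<open>k\<close> positions.\<close>

definition empirical :: "nat \<Rightarrow> (nat \<Rightarrow> bit list) \<Rightarrow> bit list pmf" where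
  "empirical k S = map_pmf S (pmf_of_set {..<k})"

lemma empirical_in_cube_pmfs:
  assumes "S \<in> tuples k (cube n)" "1 \<le> k"
  shows "empirical k S \<in> cube_pmfs n"
proof -
  have "set_pmf (pmf_of_set {..<k}) = {..<k}" using assms(2) by (intro set_pmf_of_set) (auto simp: lessThan_empty_iff)
  then show ?thesis using assms(1) by (auto simp: cube_pmfs_def empirical_def)
qed

lemma return_in_cube_pmfs: "y \<in> cube n \<Longrightarrow> return_pmf y \<in> cube_pmfs n"
  by (simp add: cube_pmfs_def)

lemma bilinear_mean_empirical:
  assumes "1 \<le> k"
  shows "bilinear_mean f (empirical k S) (return_pmf y) = (\<Sum>i<k. f (S i) y) / real k"
proof -
  have "{..<k} \<noteq> {}" using assms by (simp add: lessThan_empty_iff)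
  then show ?thesis
    by (simp add: bilinear_mean_def empirical_def pair_return_pmf2 integral_pmf_of_set)
qed

text \<open>The weighted failure has expectation at most \<open>\<delta>\<close> times the total
  weight, so some coins do at least as well. Arbitrary weights allow tilted input laws.
  Measurability is known for the success events only, so the integrand is built from their
  indicators.\<close>

lemma fixed_coins:
  fixes w :: "'i \<Rightarrow> real"
  assumes est: "one_way_estimates n f \<epsilon> \<delta> M A B"
    and I: "finite I" "\<And>i. i \<in> I \<Longrightarrow> 0 \<le> w i"
    and P: "\<And>i. i \<in> I \<Longrightarrow> P i \<in> cube_pmfs n" "\<And>i. i \<in> I \<Longrightarrow> Q i \<in> cube_pmfs n"
  shows "\<exists>r\<in>space M. (\<Sum>i\<in>I. w i * of_bool (\<not> \<bar>B r (A r (P i)) (Q i) - bilinear_mean f (P i) (Q i)\<bar> \<le> \<epsilon>))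
           \<le> \<delta> * (\<Sum>i\<in>I. w i)"
proof (rule ccontr)
  assume *: "\<not> ?thesis"
  interpret prob_space M using est by (simp add: one_way_estimates_def)
  define good where "good i = {r \<in> space M. \<bar>B r (A r (P i)) (Q i) - bilinear_mean f (P i) (Q i)\<bar> \<le> \<epsilon>}" for i
  have good: "good i \<in> sets M" "1 - \<delta> \<le> measure M (good i)" if "i \<in> I" for i
    using est P[OF that] by (auto simp: one_way_estimates_def Let_def good_def)
  define h where "h r = (\<Sum>i\<in>I. w i * (indicator (good i) r - 1))" for r
  have int: "integrable M (\<lambda>r. w i * (indicator (good i) r - 1))" if "i \<in> I" for i
    using good[OF that]
    by (intro integrable_mult_right Bochner_Integration.integrable_diff integrable_real_indicator)
      (auto simp: less_top[symmetric])
  have hb: "h r < - (\<delta> * (\<Sum>i\<in>I. w i))" if r: "r \<in> space M" for r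
  proof -
    have "h r = - (\<Sum>i\<in>I. w i * of_bool (\<not> \<bar>B r (A r (P i)) (Q i) - bilinear_mean f (P i) (Q i)\<bar> \<le> \<epsilon>))"
      unfolding h_def sum_negf[symmetric] using r by (intro sum.cong) (auto simp: good_def)
    then show ?thesis using * r by force
  qed
  have "expectation h < - (\<delta> * (\<Sum>i\<in>I. w i))"
  proof (rule expectation_less)
    show "integrable M h" unfolding h_def using int by (intro Bochner_Integration.integrable_sum)
    show "AE r in M. h r < - (\<delta> * (\<Sum>i\<in>I. w i))" using hb by (intro AE_I2) auto
  qed
  moreover have "expectation h = (\<Sum>i\<in>I. w i * (measure M (good i) - 1))"
  proof -
    have "expectation h = (\<Sum>i\<in>I. expectation (\<lambda>r. w i * (indicator (good i) r - 1)))"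
      unfolding h_def using int by (intro Bochner_Integration.integral_sum)
    also have "\<dots> = (\<Sum>i\<in>I. w i * (measure M (good i) - 1))"
    proof (intro sum.cong refl)
      fix i assume "i \<in> I"
      then have "integrable M (indicator (good i) :: _ \<Rightarrow> real)" using good
        by (intro integrable_real_indicator) (auto simp: less_top[symmetric])
      then show "expectation (\<lambda>r. w i * (indicator (good i) r - 1)) = w i * (measure M (good i) - 1)"
        using good(1)[OF \<open>i \<in> I\<close>] sets.sets_into_space[OF good(1)[OF \<open>i \<in> I\<close>]]
        by (simp add: prob_space Int_absorb2)
    qed
    finally show ?thesis .
  qed
  moreover have "- (\<delta> * (\<Sum>i\<in>I. w i)) \<le> (\<Sum>i\<in>I. w i * (measure M (good i) - 1))"
  proof -
    have "(\<Sum>i\<in>I. w i * (- \<delta>)) \<le> (\<Sum>i\<in>I. w i * (measure M (good i) - 1))"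
      using I good(2) by (intro sum_mono mult_left_mono) force+
    then show ?thesis by (simp add: sum_distrib_left sum_negf mult_ac)
  qed
  ultimately show False by linarith
qed

lemma fixed_coins_mean:
  assumes est: "one_way_estimates n f \<epsilon> \<delta> M A B"
    and fin: "finite I" "finite Y" "Y \<subseteq> cube n"
    and w: "\<And>i y. i \<in> I \<Longrightarrow> y \<in> Y \<Longrightarrow> 0 \<le> w i y"
    and P: "\<And>i. i \<in> I \<Longrightarrow> P i \<in> cube_pmfs n"
  shows "\<exists>r\<in>space M. mean I (\<lambda>i. mean Y (\<lambda>y. w i y *
            of_bool (\<not> \<bar>B r (A r (P i)) (return_pmf y) - bilinear_mean f (P i) (return_pmf y)\<bar> \<le> \<epsilon>)))
          \<le> \<delta> * mean I (\<lambda>i. mean Y (w i))"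
proof -
  obtain r where "r \<in> space M" and le: "(\<Sum>z\<in>I \<times> Y. (case z of (i, y) \<Rightarrow> w i y) *
      of_bool (\<not> \<bar>B r (A r (P (fst z))) (return_pmf (snd z)) - bilinear_mean f (P (fst z)) (return_pmf (snd z))\<bar> \<le> \<epsilon>))
       \<le> \<delta> * (\<Sum>z\<in>I \<times> Y. (case z of (i, y) \<Rightarrow> w i y))"
    using fixed_coins[OF est, of "I \<times> Y" "\<lambda>(i, y). w i y" "\<lambda>z. P (fst z)" "\<lambda>z. return_pmf (snd z)"]
      fin w P return_in_cube_pmfs by fastforce
  have "mean I (\<lambda>i. mean Y (\<lambda>y. w i y *
      of_bool (\<not> \<bar>B r (A r (P i)) (return_pmf y) - bilinear_mean f (P i) (return_pmf y)\<bar> \<le> \<epsilon>)))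
      \<le> (\<delta> * (\<Sum>z\<in>I \<times> Y. (case z of (i, y) \<Rightarrow> w i y))) / (real (card I) * real (card Y))"
    unfolding mean_Times by (intro divide_right_mono order_trans[OF _ le])
      (auto intro!: sum_mono simp: case_prod_beta)
  then show ?thesis using \<open>r \<in> space M\<close> unfolding mean_Times by auto
qed

lemma card_messages_le:
  "finite {m :: message. length m \<le> C}" "real (card {m :: message. length m \<le> C}) \<le> 2 ^ (C + 1)"
proof -
  have eq: "{m :: message. length m \<le> C} = {m. set m \<subseteq> UNIV \<and> length m \<le> C}" by simp
  show "finite {m :: message. length m \<le> C}" unfolding eq by (rule finite_lists_length_le) simp
  have "card {m :: message. length m \<le> C} = (\<Sum>i\<le>C. 2 ^ i)"
    unfolding eq by (subst card_lists_length_le) (auto simp: numeral_2_eq_2)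
  also have "\<dots> \<le> 2 ^ (C + 1)"
    using sum_power2[of "C + 1"] by (simp add: atLeast0LessThan lessThan_Suc_atMost)
  finally show "real (card {m :: message. length m \<le> C}) \<le> 2 ^ (C + 1)"
    by (metis of_nat_le_iff of_nat_numeral of_nat_power)
qed

section \<open>Choice of the parameters\<close>

text \<open>Take logarithms with \<open>2 \<le> exp 1\<close> and \<open>20 \<le> exp 4\<close>; the
  6 collects two extra factors 2 and the \<open>1/20\<close>.\<close>

lemma message_length_from_count:
  assumes le: "1/20 \<le> real N * (2 * (exp 24 * exp (- a)) ^ t * 20 ^ k)" and N: "real N \<le> 2 ^ (C + 1)"
  shows "real t * (a - 24) \<le> real C + 4 * real k + 6"
proof -
  have e1: "5/2 \<le> exp (1::real)" using exp_lower_Taylor_quadratic[of 1] by simp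
  have "(20::real) \<le> (5/2) ^ 4" by (simp add: power4_eq_xxxx)
  also have "\<dots> \<le> exp 1 ^ 4" using e1 by (intro power_mono) auto
  finally have e4: "20 \<le> exp (4::real)" by (simp add: exp_of_nat_mult[symmetric])
  have "1/20 \<le> 2 ^ (C + 1) * (2 * (exp 24 * exp (- a)) ^ t * (20::real) ^ k)"
    using N by (intro order_trans[OF le] mult_right_mono) auto
  also have "\<dots> = 2 ^ (C + 2) * 20 ^ k * (exp 24 * exp (- a)) ^ t" by simp
  also have "(exp 24 * exp (- a)) ^ t = exp (real t * (24 - a))"
    by (simp add: exp_of_nat_mult exp_diff exp_minus divide_inverse)
  also have "2 ^ (C + 2) * 20 ^ k * exp (real t * (24 - a)) \<le> exp 1 ^ (C + 2) * exp 4 ^ k * exp (real t * (24 - a))"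
    using e1 e4 by (intro mult_right_mono mult_mono power_mono) auto
  also have "\<dots> = exp (real (C + 2) + 4 * real k + real t * (24 - a))"
    by (simp add: exp_of_nat_mult[symmetric] exp_add[symmetric] mult_ac del: of_nat_add)
  finally have "1 \<le> 20 * exp (real (C + 2) + 4 * real k + real t * (24 - a))" by simp
  also have "\<dots> \<le> exp 4 * exp (real (C + 2) + 4 * real k + real t * (24 - a))"
    using e4 by (intro mult_right_mono) auto
  finally have "1 \<le> exp (4 + (real (C + 2) + 4 * real k + real t * (24 - a)))"
    by (simp only: exp_add)
  then show ?thesis by (simp add: algebra_simps)
qed

text \<open>Since \<open>ln 2 \<ge> 2/3\<close>, the power of 2 exceeds \<open>exp (n / 2)\<close>
  by a factor \<open>exp (n / 6)\<close>, and the fourth power of \<open>n / 24\<close> below that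
  factor absorbs the polynomial.\<close>

lemma two_power_ge:
  assumes "10 ^ 9 \<le> n"
  shows "10 ^ 10 * (real n)\<^sup>2 * exp (real n / 2) \<le> real (2 ^ n - 1)"
proof -
  define x where "x = real n"
  have x: "10 ^ 9 \<le> x" using assms by (simp add: x_def)
  have "10 ^ 18 \<le> x\<^sup>2" using power_mono[OF x, of 2] by simp
  then have "2 * 10 ^ 10 * 24 ^ 4 * x\<^sup>2 \<le> x\<^sup>2 * x\<^sup>2" by (intro mult_right_mono) auto
  then have "2 * 10 ^ 10 * x\<^sup>2 \<le> (x / 24) ^ 4" by (simp add: power_divide power2_eq_square power4_eq_xxxx)
  also have "\<dots> \<le> exp (x / 24) ^ 4"
  proof (rule power_mono)
    show "x / 24 \<le> exp (x / 24)" using exp_ge_add_one_self[of "x / 24"] by linarith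
  qed (use x in simp)
  also have "\<dots> = exp (x / 6)" by (simp add: exp_of_nat_mult[symmetric])
  finally have "2 * 10 ^ 10 * x\<^sup>2 * exp (x / 2) \<le> exp (x / 6) * exp (x / 2)" by (intro mult_right_mono) auto
  also have "\<dots> = exp (2/3 * x)" by (simp add: exp_add[symmetric])
  also have "\<dots> \<le> exp (ln 2 * x)" using ln2_ge_two_thirds x by (intro iffD2[OF exp_le_cancel_iff] mult_right_mono) auto
  also have "\<dots> = 2 ^ n" by (simp add: x_def exp_of_nat2_mult)
  finally have a: "2 * 10 ^ 10 * x\<^sup>2 * exp (x / 2) \<le> 2 ^ n" .
  have "1 * 1 * 1 \<le> 10 ^ 10 * x\<^sup>2 * exp (x / 2)"
    using x \<open>10 ^ 18 \<le> x\<^sup>2\<close> by (intro mult_mono) auto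
  then have "10 ^ 10 * x\<^sup>2 * exp (x / 2) \<le> 2 ^ n - 1" using a by linarith
  then show ?thesis by (simp add: x_def of_nat_diff)
qed

text \<open>Budget of exponents: \<open>n / 10\<close> for the power of
  \<open>1 + \<rho>\<^sup>2\<close>, \<open>n / 25\<close> for the factor
  \<open>\<epsilon> ^ (-4)\<close> in \<open>t\<^sup>2\<close> or \<open>k\<^sup>2\<close>, and
  \<open>n / 4\<close> for the cap. Their sum is below \<open>n / 2\<close>.\<close>

lemma parameters_admissible:
  fixes \<epsilon> \<rho> :: real
  assumes n: "10 ^ 9 \<le> n" and \<epsilon>: "2 powr (- (real n / 100)) < \<epsilon>" "\<epsilon> < 1"
    and \<rho>: "0 < \<rho>" "\<rho> \<le> 1" and k: "\<rho>\<^sup>2 * real k \<le> real n / 10" "real k \<le> real n / \<epsilon>\<^sup>2"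
    and t: "\<rho>\<^sup>2 * real t \<le> real n / 8" "real t \<le> real n / \<epsilon>\<^sup>2"
  shows "1200 * (1 + \<rho>\<^sup>2) ^ k * \<rho>\<^sup>2 * (real t)\<^sup>2 * exp (2 * \<rho>\<^sup>2 * real t) \<le> real (2 ^ n - 1)"
    and "10000 * (real k)\<^sup>2 * (1 + \<rho>\<^sup>2) ^ k \<le> real (2 ^ n - 1)"
proof -
  define x where "x = real n"
  have e0: "0 < \<epsilon>" using \<epsilon>(1) by (meson powr_ge_zero le_less_trans)
  have V: "(1 + \<rho>\<^sup>2) ^ k \<le> exp (x / 10)"
  proof -
    have "(1 + \<rho>\<^sup>2) ^ k \<le> exp (\<rho>\<^sup>2) ^ k"
      by (intro power_mono exp_ge_add_one_self) (simp add: add_nonneg_nonneg)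
    also have "\<dots> = exp (\<rho>\<^sup>2 * real k)" by (simp add: exp_of_nat2_mult)
    also have "\<dots> \<le> exp (x / 10)" using k by (simp add: x_def)
    finally show ?thesis .
  qed
  have inv: "1 / \<epsilon> \<le> exp (x / 100)"
  proof -
    have "1 / \<epsilon> \<le> 1 / 2 powr (- (x / 100))"
      using \<epsilon> e0 by (intro divide_left_mono) (auto simp: x_def)
    also have "\<dots> = exp (x / 100 * ln 2)" by (simp only: powr_minus_divide) (simp add: powr_def)
    also have "\<dots> \<le> exp (x / 100 * 1)"
      using ln2_le_25_over_36 by (intro iffD2[OF exp_le_cancel_iff] mult_left_mono) (auto simp: x_def)
    finally have "1 / \<epsilon> \<le> exp (x / 100 * 1)" .
    then show ?thesis by (simp only: mult_1_right)
  qed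
  have "(x / \<epsilon>\<^sup>2)\<^sup>2 = x\<^sup>2 * (1 / \<epsilon>) ^ 4" by (simp add: power_divide power_mult[symmetric])
  also have "\<dots> \<le> x\<^sup>2 * exp (x / 100) ^ 4"
    using inv e0 by (intro mult_left_mono power_mono) auto
  also have "\<dots> = x\<^sup>2 * exp (x / 25)" by (simp add: exp_of_nat_mult[symmetric])
  finally have sq: "(x / \<epsilon>\<^sup>2)\<^sup>2 \<le> x\<^sup>2 * exp (x / 25)" .
  have tt: "(real t)\<^sup>2 \<le> x\<^sup>2 * exp (x / 25)"
    using t(2) by (intro order_trans[OF _ sq] power_mono) (auto simp: x_def)
  have kk: "(real k)\<^sup>2 \<le> x\<^sup>2 * exp (x / 25)"
    using k(2) by (intro order_trans[OF _ sq] power_mono) (auto simp: x_def)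
  have r1: "\<rho>\<^sup>2 \<le> 1" using \<rho> by (simp add: power_le_one)
  have "1200 * (1 + \<rho>\<^sup>2) ^ k * \<rho>\<^sup>2 * (real t)\<^sup>2 * exp (2 * \<rho>\<^sup>2 * real t) \<le>
      10 ^ 10 * exp (x / 10) * 1 * (x\<^sup>2 * exp (x / 25)) * exp (x / 4)"
    using V tt r1 t(1) by (intro mult_mono) (auto simp: x_def)
  also have "\<dots> = 10 ^ 10 * x\<^sup>2 * exp (x / 10 + x / 25 + x / 4)"
    by (simp only: exp_add mult_1_right mult_ac)
  also have "\<dots> \<le> 10 ^ 10 * x\<^sup>2 * exp (x / 2)" by (intro mult_left_mono) (auto simp: x_def)
  also have "\<dots> \<le> real (2 ^ n - 1)" unfolding x_def by (rule two_power_ge[OF n])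
  finally show "1200 * (1 + \<rho>\<^sup>2) ^ k * \<rho>\<^sup>2 * (real t)\<^sup>2 * exp (2 * \<rho>\<^sup>2 * real t) \<le> real (2 ^ n - 1)" .
  have "10000 * (real k)\<^sup>2 * (1 + \<rho>\<^sup>2) ^ k \<le> 10 ^ 10 * (x\<^sup>2 * exp (x / 25)) * exp (x / 10)"
    using V kk by (intro mult_mono) (auto simp: x_def)
  also have "\<dots> = 10 ^ 10 * x\<^sup>2 * exp (x / 25 + x / 10)" by (simp only: exp_add mult_ac)
  also have "\<dots> \<le> 10 ^ 10 * x\<^sup>2 * exp (x / 2)" by (intro mult_left_mono) (auto simp: x_def)
  also have "\<dots> \<le> real (2 ^ n - 1)" unfolding x_def by (rule two_power_ge[OF n])
  finally show "10000 * (real k)\<^sup>2 * (1 + \<rho>\<^sup>2) ^ k \<le> real (2 ^ n - 1)" .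
qed

section \<open>Discrepancy bound and rounding\<close>

lemma (in sign_matrix) mean_mean_tilt: "mean (tuples k X) (\<lambda>S. mean Y (tilt \<rho> k S)) = 1"
  using mean_mass unfolding mass_def .

text \<open>By Jensen it suffices to bound the mean square of the correlation. There the one message
  sent for \<open>x\<close> may be replaced by the sum over all messages, and for each fixed message
  orthogonality leaves only the diagonal.\<close>

lemma (in sign_matrix) correlation_bound:
  assumes M: "finite M" and enc: "\<And>x. x \<in> X \<Longrightarrow> enc x \<in> M" and h: "\<And>m y. (h m y)\<^sup>2 \<le> 1"
  shows "(mean X (\<lambda>x. mean Y (\<lambda>y. \<xi> x y * h (enc x) y)))\<^sup>2 \<le> real (card M) / real (card Y)"
proof -
  define c where "c m x = mean Y (\<lambda>y. \<xi> x y * h m y)" for m x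
  define a where "a = mean X (\<lambda>x. c (enc x) x)"
  have "0 \<le> mean X (\<lambda>x. (c (enc x) x - a)\<^sup>2)" by (intro mean_nonneg) auto
  also have "\<dots> = mean X (\<lambda>x. (c (enc x) x)\<^sup>2 + ((- 2 * a) * c (enc x) x + a\<^sup>2))"
    by (simp add: power2_diff algebra_simps)
  also have "\<dots> = mean X (\<lambda>x. (c (enc x) x)\<^sup>2) - a\<^sup>2"
    by (simp only: mean_add mean_cmult a_def[symmetric] mean_const[OF finite_X X_ne])
      (simp add: power2_eq_square)
  finally have "a\<^sup>2 \<le> mean X (\<lambda>x. (c (enc x) x)\<^sup>2)" by simp
  also have "\<dots> \<le> mean X (\<lambda>x. \<Sum>m\<in>M. (c m x)\<^sup>2)"
    using M enc member_le_sum[of _ M "\<lambda>m. (c m _)\<^sup>2"] by (intro mean_mono) auto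
  also have "\<dots> = (\<Sum>m\<in>M. mean X (\<lambda>x. (c m x)\<^sup>2))" by (rule mean_sum)
  also have "\<dots> \<le> (\<Sum>m\<in>M. 1 / real (card Y))"
  proof (rule sum_mono)
    fix m
    have "mean X (\<lambda>x. (c m x)\<^sup>2) = mean X (\<lambda>x. mean Y (\<lambda>y. mean Y (\<lambda>z. \<xi> x y * h m y * (\<xi> x z * h m z))))"
      by (simp add: c_def power2_eq_square mean_mult_mean)
    also have "\<dots> = mean Y (\<lambda>y. mean Y (\<lambda>z. mean X (\<lambda>x. (h m y * h m z) * (\<xi> x y * \<xi> x z))))"
      by (simp add: mean_swap[of X] mult_ac)
    also have "\<dots> \<le> 0 + \<bar>1\<bar> / real (card Y)"
    proof (rule mean_mean_le_diagonal)
      fix y assume "y \<in> Y"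
      show "mean X (\<lambda>x. (h m y * h m y) * (\<xi> x y * \<xi> x y)) \<le> 1"
        using h[of m y] by (simp add: sign_square mean_const finite_X X_ne power2_eq_square)
    qed (auto simp: finite_Y Y_ne mean_cmult mean_sign_sign)
    finally show "mean X (\<lambda>x. (c m x)\<^sup>2) \<le> 1 / real (card Y)" by simp
  qed
  finally show ?thesis by (simp add: a_def c_def)
qed

lemma nat_ceiling_bounds: "0 \<le> x \<Longrightarrow> x \<le> real (nat \<lceil>x\<rceil>)" "0 \<le> x \<Longrightarrow> real (nat \<lceil>x\<rceil>) \<le> x + 1"
  for x :: real
  by linarith+

lemma nat_floor_bounds: "0 \<le> x \<Longrightarrow> real (nat \<lfloor>x\<rfloor>) \<le> x" "0 \<le> x \<Longrightarrow> x - 1 \<le> real (nat \<lfloor>x\<rfloor>)"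
  for x :: real
  by linarith+

section \<open>Message length for the inner product\<close>

locale inner_product_cube =
  fixes n :: nat
  assumes n_pos: "1 \<le> n"

sublocale inner_product_cube \<subseteq> sign_matrix "cube n" "nonzero_cube n" "ip_sign n"
  by (rule ip_sign_matrix[OF n_pos])

context inner_product_cube
begin

lemma nonzero_subset_cube: "nonzero_cube n \<subseteq> cube n"
  by (auto simp: nonzero_cube_def)

lemma bilinear_mean_eq_sample_mean:
  "1 \<le> k \<Longrightarrow> bilinear_mean (ip_sign n) (empirical k S) (return_pmf y) = sample_mean k S y"
  by (simp add: bilinear_mean_empirical sample_mean_def)

text \<open>Here \<open>exp (- a)\<close> plays the role of \<open>\<tau>\<close>: each of the
  \<open>t\<close> points forces \<open>a - 24\<close> nats into the message.\<close>

lemma counting_message_length: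
  fixes \<epsilon> \<rho> :: real
  assumes n: "10 ^ 9 \<le> n" and \<epsilon>: "2 powr (- (real n / 100)) < \<epsilon>" "\<epsilon> < 1"
    and \<rho>: "0 < \<rho>" "\<rho> \<le> 1" and k: "1 \<le> k" "\<rho>\<^sup>2 * real k \<le> real n / 10" "real k \<le> real n / \<epsilon>\<^sup>2"
    and t: "k \<le> t" "\<rho>\<^sup>2 * real t \<le> real n / 8" "real t \<le> real n / \<epsilon>\<^sup>2"
    and r: "r \<in> space M" and len: "message_length_le n M A C"
    and sub: "\<And>m. \<Phi> m \<subseteq> nonzero_cube n"
    and succ: "1/10 \<le> mean (tuples k (cube n)) (\<lambda>S.
        of_bool (real (card (\<Phi> (A r (empirical k S)))) \<le> exp (- a) * real (card (nonzero_cube n)) \<and>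
          mean (nonzero_cube n) (\<lambda>y. tilt \<rho> k S y * of_bool (y \<notin> \<Phi> (A r (empirical k S)))) \<le> 3/5))"
  shows "real t * (a - 24) \<le> real C + 4 * real k + 6"
proof (rule message_length_from_count[OF _ card_messages_le(2)])
  have "A r (empirical k S) \<in> {m. length m \<le> C}" if "S \<in> tuples k (cube n)" for S
    using len r empirical_in_cube_pmfs[OF that k(1)] by (simp add: message_length_le_def)
  then show "1/20 \<le> real (card {m :: message. length m \<le> C}) * (2 * (exp 24 * exp (- a)) ^ t * 20 ^ k)"
    using parameters_admissible[OF n \<epsilon> \<rho> k(2,3) t(2,3)]
    by (intro encoding_bound[OF \<rho> k(1) t(1) card_messages_le(1) _ sub _ _ succ])
      (auto simp: card_nonzero_cube)
qed

lemma failing_coins: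
  assumes est: "one_way_estimates n (ip_sign n) \<epsilon> \<delta> M A B" and k: "1 \<le> k"
    and w: "\<And>S y. 0 \<le> w S y" and w1: "mean (tuples k (cube n)) (\<lambda>S. mean (nonzero_cube n) (w S)) = c"
  shows "\<exists>r\<in>space M. mean (tuples k (cube n)) (\<lambda>S. mean (nonzero_cube n) (\<lambda>y. w S y *
            of_bool (\<not> \<bar>B r (A r (empirical k S)) (return_pmf y) - sample_mean k S y\<bar> \<le> \<epsilon>))) \<le> \<delta> * c"
  using fixed_coins_mean[OF est finite_tuples[OF finite_X, of k] finite_Y nonzero_subset_cube, of w "empirical k"]
    w w1 empirical_in_cube_pmfs k by (simp add: bilinear_mean_eq_sample_mean)

text \<open>One threshold test suffices: under the uniform law both a wrong estimate and a large
  sample mean have probability exponentially small in \<open>ln (1 / \<delta>)\<close>, so the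
  accepted set is that small for most tuples.\<close>

lemma small_error_message_length:
  assumes n: "10 ^ 9 \<le> n" and \<epsilon>: "2 powr (- (real n / 100)) < \<epsilon>" "\<epsilon> < 1/3"
    and \<delta>: "2 powr (- real n) < \<delta>" and \<Lambda>: "10 ^ 6 \<le> ln (1 / \<delta>)"
    and est: "one_way_estimates n (ip_sign n) \<epsilon> \<delta> M A B" and len: "message_length_le n M A C"
  shows "real n * ln (1 / \<delta>) / \<epsilon>\<^sup>2 \<le> 4 * 10 ^ 6 * real C"
proof -
  define x \<Lambda> q where "x = real n" and "\<Lambda> = ln (1 / \<delta>)" and "q = 1 / \<epsilon>\<^sup>2"
  have e0: "0 < \<epsilon>" using \<epsilon>(1) by (meson powr_ge_zero le_less_trans)
  have d0: "0 < \<delta>" using \<delta> by (meson powr_ge_zero le_less_trans)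
  have x: "1000000000 \<le> x" using n by (simp add: x_def)
  have \<Lambda>6: "1000000 \<le> \<Lambda>" using \<Lambda> by (simp add: \<Lambda>_def)
  \<comment> \<open>The lower bound on \<open>\<delta>\<close> enters here: it makes
    \<open>k\<close>, of order \<open>\<Lambda> * q\<close>, fit below \<open>t\<close>, of order
    \<open>x * q\<close>.\<close>
  have \<Lambda>x: "\<Lambda> \<le> x"
  proof -
    have "ln (2 powr (- x)) \<le> ln \<delta>" using \<delta> d0 by (subst ln_le_cancel_iff) (auto simp: x_def)
    then have "\<Lambda> \<le> x * ln 2" using d0 by (simp add: \<Lambda>_def ln_div ln_powr)
    also have "\<dots> \<le> x * 1" using ln2_le_25_over_36 x by (intro mult_left_mono) auto
    finally show ?thesis by simp
  qed
  have eq: "\<epsilon>\<^sup>2 * q = 1" using e0 by (simp add: q_def)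
  have e2: "\<epsilon>\<^sup>2 < 1/9" using power_strict_mono[OF \<epsilon>(2), of 2] e0 by (simp add: power2_eq_square)
  have q9: "9 \<le> q" using e2 e0 by (simp add: q_def field_simps)
  have dL: "\<delta> = exp (- \<Lambda>)" using d0 by (simp add: \<Lambda>_def exp_minus ln_div)
  \<comment> \<open>Sample means near 0 and near \<open>\<rho>\<close> must stay apart after an
    error \<open>\<epsilon>\<close> and a deviation \<open>3/10 * \<epsilon>\<close> on each side,
    so \<open>\<rho>\<close> exceeds \<open>26/10 * \<epsilon>\<close>. As
    \<open>\<epsilon> < 1/3\<close>, it is below 1. The threshold in \<open>\<Phi>\<close> below is
    the midpoint.\<close>
  define \<rho> where "\<rho> = 27/10 * \<epsilon>"
  have \<rho>: "0 < \<rho>" "\<rho> \<le> 1" using e0 \<epsilon> by (auto simp: \<rho>_def)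
  have \<rho>2: "\<rho>\<^sup>2 = 729/100 * \<epsilon>\<^sup>2" by (simp add: \<rho>_def power2_eq_square)
  \<comment> \<open>This \<open>k\<close> makes the tail exponent
    \<open>(3/10 * \<epsilon>)\<^sup>2 * k / 4\<close> at least \<open>\<Lambda> / 5000\<close>; the
    60 in \<open>t\<close> gives \<open>729/100 / 60 \<le> 1/8\<close>.\<close>
  define k where "k = nat \<lceil>\<Lambda> * q / 100\<rceil>"
  define t where "t = nat \<lfloor>x * q / 60\<rfloor>"
  have \<Lambda>q: "9000000 \<le> \<Lambda> * q" using mult_mono[OF \<Lambda>6 q9] \<Lambda>6 by simp
  have k: "\<Lambda> * q / 100 \<le> real k" "real k \<le> \<Lambda> * q / 100 + 1"
    using \<Lambda>q nat_ceiling_bounds[of "\<Lambda> * q / 100"] by (simp_all add: k_def)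
  have xq: "9000000000 \<le> x * q" using mult_mono[OF x q9] x by simp
  have t: "real t \<le> x * q / 60" "x * q / 60 - 1 \<le> real t"
    using xq nat_floor_bounds[of "x * q / 60"] by (simp_all add: t_def)
  have \<Lambda>qx: "\<Lambda> * q \<le> x * q" using \<Lambda>x q9 by (intro mult_right_mono) auto
  have k1: "1 \<le> k" using k(1) \<Lambda>q by linarith
  have kt: "k \<le> t" using k t xq \<Lambda>qx by linarith
  have kn: "real k \<le> real n / \<epsilon>\<^sup>2" and tn': "real t \<le> real n / \<epsilon>\<^sup>2"
    using k t xq \<Lambda>qx by (auto simp: x_def q_def)
  have ek: "\<Lambda> / 100 \<le> \<epsilon>\<^sup>2 * real k"
  proof -
    have "\<Lambda> / 100 = (\<epsilon>\<^sup>2 * q) * \<Lambda> / 100" by (simp add: eq)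
    also have "\<dots> = \<epsilon>\<^sup>2 * (\<Lambda> * q / 100)" by (simp only: mult_ac times_divide_eq_right)
    also have "\<dots> \<le> \<epsilon>\<^sup>2 * real k" using k by (intro mult_left_mono) auto
    finally show ?thesis .
  qed
  have \<rho>k: "\<rho>\<^sup>2 * real k \<le> real n / 10"
  proof -
    have "\<epsilon>\<^sup>2 * real k \<le> \<epsilon>\<^sup>2 * (\<Lambda> * q / 100 + 1)" using k by (intro mult_left_mono) auto
    also have "\<dots> = (\<epsilon>\<^sup>2 * q) * \<Lambda> / 100 + \<epsilon>\<^sup>2" by (simp add: algebra_simps)
    also have "\<dots> \<le> x / 100 + 1/9" using e2 \<Lambda>x unfolding eq by simp
    finally have "729/100 * (\<epsilon>\<^sup>2 * real k) \<le> x / 10" using x by linarith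
    then show ?thesis by (simp only: \<rho>2 mult.assoc x_def)
  qed
  have \<rho>t: "\<rho>\<^sup>2 * real t \<le> real n / 8"
  proof -
    have "\<epsilon>\<^sup>2 * real t \<le> \<epsilon>\<^sup>2 * (x * q / 60)" using t by (intro mult_left_mono) auto
    also have "\<dots> = (\<epsilon>\<^sup>2 * q) * x / 60" by (simp add: algebra_simps)
    finally have "729/100 * (\<epsilon>\<^sup>2 * real t) \<le> x / 8" using x unfolding eq by linarith
    then show ?thesis by (simp only: \<rho>2 mult.assoc x_def)
  qed
  let ?T = "tuples k (cube n)" and ?Y = "nonzero_cube n"
  have finT: "finite ?T" "?T \<noteq> {}" by (simp_all add: finite_tuples finite_X tuples_nonempty X_ne del: PiE_eq_empty_iff)
  have tn: "0 \<le> tilt \<rho> k S y" for S y using tilt_nonneg[of \<rho> k S y] \<rho> by simp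
  then have w0: "0 \<le> 1 + tilt \<rho> k S y" for S y by (simp add: add_nonneg_nonneg)
  have w1: "mean ?T (\<lambda>S. mean ?Y (\<lambda>y. 1 + tilt \<rho> k S y)) = 2"
    by (simp add: mean_add mean_const finT finite_Y Y_ne mean_mean_tilt)
  \<comment> \<open>The weight \<open>1 + tilt\<close> lets a single choice of coins serve the
    uniform and the tilted law at once, each with failure at most
    \<open>2 * \<delta>\<close>.\<close>
  obtain r where r: "r \<in> space M" and fail: "mean ?T (\<lambda>S. mean ?Y (\<lambda>y. (1 + tilt \<rho> k S y) *
      of_bool (\<not> \<bar>B r (A r (empirical k S)) (return_pmf y) - sample_mean k S y\<bar> \<le> \<epsilon>))) \<le> \<delta> * 2"
    using failing_coins[OF est k1 w0 w1] by blast
  define F where "F S y = (of_bool (\<not> \<bar>B r (A r (empirical k S)) (return_pmf y) - sample_mean k S y\<bar> \<le> \<epsilon>) :: real)" for S y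
  define \<Phi> where "\<Phi> m = {y \<in> ?Y. 27/20 * \<epsilon> \<le> B r m (return_pmf y)}" for m
  let ?\<Phi> = "\<lambda>S. \<Phi> (A r (empirical k S))"
  define F1 F2 where "F1 = mean ?T (\<lambda>S. mean ?Y (F S))" and "F2 = mean ?T (\<lambda>S. mean ?Y (\<lambda>y. tilt \<rho> k S y * F S y))"
  have F12: "F1 + F2 \<le> 2 * \<delta>"
    using fail by (simp add: F1_def F2_def F_def[symmetric] distrib_right mean_add)
  have F0: "0 \<le> F1" "0 \<le> F2"
    unfolding F1_def F2_def using tn by (simp_all add: mean_nonneg F_def)
  have sizes: "mean ?T (\<lambda>S. real (card (?\<Phi> S)) / real (card ?Y)) \<le> 3 * exp (- \<Lambda> / 5000)"
  proof -
    have card: "real (card (?\<Phi> S)) / real (card ?Y) = mean ?Y (\<lambda>y. of_bool (y \<in> ?\<Phi> S))" for S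
      by (rule mean_of_bool_mem[symmetric, OF finite_Y]) (auto simp: \<Phi>_def)
    have "mean ?T (\<lambda>S. real (card (?\<Phi> S)) / real (card ?Y)) \<le>
        mean ?T (\<lambda>S. mean ?Y (\<lambda>y. F S y + of_bool (3/10 * \<epsilon> \<le> sample_mean k S y)))"
      unfolding card
    proof (intro mean_mono)
      fix S y
      show "of_bool (y \<in> ?\<Phi> S) \<le> F S y + of_bool (3/10 * \<epsilon> \<le> sample_mean k S y)"
        using e0 by (auto simp: \<Phi>_def F_def of_bool_def)
    qed
    also have "\<dots> = F1 + mean ?Y (\<lambda>y. mean ?T (\<lambda>S. of_bool (3/10 * \<epsilon> \<le> sample_mean k S y)))"
      by (simp add: mean_add F1_def mean_swap[of ?T])
    also have "\<dots> \<le> F1 + mean ?Y (\<lambda>y. exp (- (3/10 * \<epsilon>)\<^sup>2 * real k / 4))"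
      using e0 \<epsilon> k1 by (intro add_left_mono mean_mono sample_mean_tail) auto
    also have "\<dots> = F1 + exp (- (3/10 * \<epsilon>)\<^sup>2 * real k / 4)"
      by (simp add: mean_const finite_Y Y_ne)
    also have "\<dots> \<le> 2 * exp (- \<Lambda> / 5000) + exp (- \<Lambda> / 5000)"
    proof (intro add_mono)
      have "exp (- \<Lambda>) \<le> exp (- \<Lambda> / 5000)" using \<Lambda>6 by (subst exp_le_cancel_iff) linarith
      then show "F1 \<le> 2 * exp (- \<Lambda> / 5000)" using F12 F0 dL by linarith
      have "- (9/100 * (\<epsilon>\<^sup>2 * real k)) / 4 \<le> - \<Lambda> / 5000" using \<Lambda>6 ek by linarith
      moreover have "(3/10 * \<epsilon>)\<^sup>2 = 9/100 * \<epsilon>\<^sup>2" by (simp add: power2_eq_square)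
      ultimately show "exp (- (3/10 * \<epsilon>)\<^sup>2 * real k / 4) \<le> exp (- \<Lambda> / 5000)"
        by (simp only: exp_le_cancel_iff mult_minus_left mult.assoc)
    qed
    finally show ?thesis by simp
  qed
  \<comment> \<open>Markov at the square root of the exponential bound leaves a failure probability
    that is still exponentially small.\<close>
  have big: "mean ?T (\<lambda>S. of_bool (exp (- (\<Lambda> / 10000)) < real (card (?\<Phi> S)) / real (card ?Y))) \<le> 1/10"
  proof -
    have "mean ?T (\<lambda>S. of_bool (exp (- (\<Lambda> / 10000)) < real (card (?\<Phi> S)) / real (card ?Y))) \<le>
        mean ?T (\<lambda>S. real (card (?\<Phi> S)) / real (card ?Y)) / exp (- (\<Lambda> / 10000))"
      by (rule mean_markov) auto
    also have "\<dots> \<le> 3 * exp (- \<Lambda> / 5000) / exp (- (\<Lambda> / 10000))"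
      using sizes by (intro divide_right_mono) auto
    also have "exp (- \<Lambda> / 5000) = exp (- (\<Lambda> / 10000)) * exp (- (\<Lambda> / 10000))"
      unfolding exp_add[symmetric] by simp
    also have "3 * (exp (- (\<Lambda> / 10000)) * exp (- (\<Lambda> / 10000))) / exp (- (\<Lambda> / 10000)) = 3 * exp (- (\<Lambda> / 10000))"
      by simp
    also have "\<dots> = 3 * (1 / exp (\<Lambda> / 10000))" by (simp only: exp_minus inverse_eq_divide)
    also have "3 * (1 / exp (\<Lambda> / 10000)) \<le> 3 * (1 / 100)"
    proof (intro mult_left_mono divide_left_mono)
      show "100 \<le> exp (\<Lambda> / 10000)" using exp_ge_add_one_self[of "\<Lambda> / 10000"] \<Lambda>6 by linarith
    qed auto
    finally show ?thesis by simp
  qed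
  have miss: "mean ?T (\<lambda>S. mean ?Y (\<lambda>y. tilt \<rho> k S y * of_bool (y \<notin> ?\<Phi> S))) \<le> 1/100"
  proof -
    have "mean ?T (\<lambda>S. mean ?Y (\<lambda>y. tilt \<rho> k S y * of_bool (y \<notin> ?\<Phi> S))) \<le>
        mean ?T (\<lambda>S. mean ?Y (\<lambda>y. tilt \<rho> k S y * F S y +
          tilt \<rho> k S y * of_bool (3/10 * \<epsilon> < \<bar>sample_mean k S y - \<rho>\<bar>)))"
    proof (intro mean_mono)
      fix S y assume y: "y \<in> ?Y"
      have "of_bool (y \<notin> ?\<Phi> S) \<le> F S y + of_bool (3/10 * \<epsilon> < \<bar>sample_mean k S y - \<rho>\<bar>)"
      proof -
        have "27/20 * \<epsilon> \<le> B r (A r (empirical k S)) (return_pmf y)"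
          if "\<bar>B r (A r (empirical k S)) (return_pmf y) - sample_mean k S y\<bar> \<le> \<epsilon>"
            "\<not> 3/10 * \<epsilon> < \<bar>sample_mean k S y - \<rho>\<bar>"
          using that e0 unfolding \<rho>_def by linarith
        then show ?thesis using y by (auto simp: \<Phi>_def F_def)
      qed
      then have "tilt \<rho> k S y * of_bool (y \<notin> ?\<Phi> S) \<le> tilt \<rho> k S y * (F S y + of_bool (3/10 * \<epsilon> < \<bar>sample_mean k S y - \<rho>\<bar>))"
        by (intro mult_left_mono tn)
      then show "tilt \<rho> k S y * of_bool (y \<notin> ?\<Phi> S) \<le> tilt \<rho> k S y * F S y +
          tilt \<rho> k S y * of_bool (3/10 * \<epsilon> < \<bar>sample_mean k S y - \<rho>\<bar>)"
        by (simp only: distrib_left)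
    qed
    also have "\<dots> = F2 + mean ?Y (\<lambda>y. mean ?T (\<lambda>S. tilt \<rho> k S y * of_bool (3/10 * \<epsilon> < \<bar>sample_mean k S y - \<rho>\<bar>)))"
      by (simp add: mean_add F2_def mean_swap[of ?T])
    also have "\<dots> \<le> F2 + mean ?Y (\<lambda>y. 1 / (real k * (3/10 * \<epsilon>)\<^sup>2))"
      using e0 \<rho> k1 by (intro add_left_mono mean_mono tilted_sample_mean_deviation) auto
    also have "\<dots> = F2 + 1 / (9/100 * (\<epsilon>\<^sup>2 * real k))"
      by (simp add: mean_const finite_Y Y_ne power2_eq_square mult_ac)
    also have "\<dots> \<le> 2 * \<delta> + 1 / (9/100 * (\<Lambda> / 100))"
    proof (intro add_mono divide_left_mono mult_left_mono)
      show "\<Lambda> / 100 \<le> \<epsilon>\<^sup>2 * real k" by (rule ek)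
      show "F2 \<le> 2 * \<delta>" using F12 F0 by linarith
      show "0 < 9/100 * (\<epsilon>\<^sup>2 * real k) * (9/100 * (\<Lambda> / 100))" using e0 k1 \<Lambda>6 by auto
    qed auto
    also have "\<dots> \<le> 2 * (1 / 1000) + 1 / 500"
    proof (intro add_mono mult_left_mono)
      have "\<delta> = 1 / exp \<Lambda>" by (simp add: dL exp_minus inverse_eq_divide)
      also have "\<dots> \<le> 1 / 1000"
      proof (rule divide_left_mono)
        show "1000 \<le> exp \<Lambda>" using exp_ge_add_one_self[of \<Lambda>] \<Lambda>6 by linarith
      qed auto
      finally show "\<delta> \<le> 1 / 1000" .
      show "1 / (9/100 * (\<Lambda> / 100)) \<le> 1 / 500" using \<Lambda>6 by (intro divide_left_mono) auto
    qed auto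
    finally show ?thesis by simp
  qed
  have light: "mean ?T (\<lambda>S. of_bool (3/5 < mean ?Y (\<lambda>y. tilt \<rho> k S y * of_bool (y \<notin> ?\<Phi> S)))) \<le> 1/10"
  proof -
    have "mean ?T (\<lambda>S. of_bool (3/5 < mean ?Y (\<lambda>y. tilt \<rho> k S y * of_bool (y \<notin> ?\<Phi> S)))) \<le>
        mean ?T (\<lambda>S. mean ?Y (\<lambda>y. tilt \<rho> k S y * of_bool (y \<notin> ?\<Phi> S))) / (3/5)"
      by (intro mean_markov mean_nonneg mult_nonneg_nonneg tn) auto
    then show ?thesis using miss by simp
  qed
  have "1 = mean ?T (\<lambda>S. 1)" using finT by (simp add: mean_const)
  also have "\<dots> \<le> mean ?T (\<lambda>S. of_bool (real (card (?\<Phi> S)) \<le> exp (- (\<Lambda> / 10000)) * real (card ?Y) \<and>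
        mean ?Y (\<lambda>y. tilt \<rho> k S y * of_bool (y \<notin> ?\<Phi> S)) \<le> 3/5) +
      (of_bool (exp (- (\<Lambda> / 10000)) < real (card (?\<Phi> S)) / real (card ?Y)) +
       of_bool (3/5 < mean ?Y (\<lambda>y. tilt \<rho> k S y * of_bool (y \<notin> ?\<Phi> S)))))"
    using card_Y_pos by (intro mean_mono) (auto simp: of_bool_def pos_less_divide_eq not_less)
  finally have "1/10 \<le> mean ?T (\<lambda>S. of_bool (real (card (?\<Phi> S)) \<le> exp (- (\<Lambda> / 10000)) * real (card ?Y) \<and>
        mean ?Y (\<lambda>y. tilt \<rho> k S y * of_bool (y \<notin> ?\<Phi> S)) \<le> 3/5))"
    using big light by (simp only: mean_add)
  then have "real t * (\<Lambda> / 10000 - 24) \<le> real C + 4 * real k + 6"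
    using \<epsilon> by (intro counting_message_length[OF n \<epsilon>(1) _ \<rho> k1 \<rho>k kn kt \<rho>t tn' r len, of \<Phi>])
      (auto simp: \<Phi>_def)
  \<comment> \<open>\<open>\<Lambda> \<ge> 10 ^ 6\<close> lets half of the gain pay for the 24. The
    term \<open>4 * k\<close>, of order \<open>\<Lambda> * q\<close>, is absorbed because the left
    side has the extra factor \<open>x \<ge> 10 ^ 9\<close>.\<close>
  moreover have "real t * (\<Lambda> / 20000) \<le> real t * (\<Lambda> / 10000 - 24)"
    using \<Lambda>6 by (intro mult_left_mono) auto
  moreover have "x * q / 120 * (\<Lambda> / 20000) \<le> real t * (\<Lambda> / 20000)"
    using t xq \<Lambda>6 by (intro mult_right_mono) auto
  moreover have "x * q / 120 * (\<Lambda> / 20000) = x * (\<Lambda> * q) / 2400000" by simp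
  moreover have "1000000000 * (\<Lambda> * q) \<le> x * (\<Lambda> * q)"
    using x \<Lambda>q by (intro mult_right_mono) auto
  ultimately have "x * (\<Lambda> * q) \<le> 4000000 * real C" using k \<Lambda>q by linarith
  then show ?thesis by (simp add: x_def \<Lambda>_def q_def)
qed

text \<open>An estimate right only half of the time still locates the sample mean among
  \<open>L\<close> separated levels. The sets that one message assigns to the levels are disjoint,
  so most have measure at most \<open>exp (- 30)\<close>; this replaces concentration as the source
  of a small \<open>\<tau>\<close>.\<close>

lemma multi_level_message_length:
  assumes n: "10 ^ 9 \<le> n" "10 ^ 8 * L\<^sup>2 \<le> n" and \<epsilon>: "2 powr (- (real n / 100)) < \<epsilon>" "4 * \<epsilon> * real L \<le> 1"
    and L: "50 * exp 30 \<le> real L" and \<delta>: "\<delta> \<le> 1/2"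
    and est: "one_way_estimates n (ip_sign n) \<epsilon> \<delta> M A B" and len: "message_length_le n M A C"
  shows "real n / \<epsilon>\<^sup>2 \<le> 100 * (real L)\<^sup>2 * real C"
proof -
  define q where "q = 1 / \<epsilon>\<^sup>2"
  have e0: "0 < \<epsilon>" using \<epsilon>(1) by (meson powr_ge_zero le_less_trans)
  have L1: "1 \<le> real L"
  proof -
    have "1 * 1 \<le> 50 * exp (30 :: real)" by (intro mult_mono) auto
    then show ?thesis using L by linarith
  qed
  \<comment> \<open>The top level has \<open>\<rho>\<close> as large as
    \<open>4 * \<epsilon> * L\<close>, so the admissible \<open>t\<close> shrinks by
    \<open>L\<^sup>2\<close>, an absolute constant in the end.\<close>
  define x where "x = real n / (real L)\<^sup>2"
  have L2: "1 \<le> (real L)\<^sup>2" using L1 by simp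
  have nx: "real n = x * (real L)\<^sup>2" using L1 by (simp add: x_def)
  have "real (10 ^ 8 * L\<^sup>2) \<le> real n" using n(2) by (simp only: of_nat_le_iff)
  then have "100000000 * (real L)\<^sup>2 \<le> x * (real L)\<^sup>2" unfolding nx by simp
  moreover have "0 < (real L)\<^sup>2" using L2 by linarith
  ultimately have x: "100000000 \<le> x" by (rule mult_right_le_imp_le)
  have xn: "x \<le> real n" unfolding nx using x L2 mult_left_mono[of 1 "(real L)\<^sup>2" x] by simp
  have eq: "\<epsilon>\<^sup>2 * q = 1" using e0 by (simp add: q_def)
  have "4 * \<epsilon> * 1 \<le> 4 * \<epsilon> * real L" using L1 e0 by (intro mult_left_mono) auto
  then have e4: "\<epsilon> \<le> 1/4" using \<epsilon>(2) by linarith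
  have e2: "\<epsilon>\<^sup>2 \<le> 1/16" using power_mono[OF e4, of 2] e0 by (simp add: power2_eq_square)
  have q16: "16 \<le> q" using e2 e0 by (simp add: q_def field_simps)
  define \<rho> where "\<rho> l = 4 * \<epsilon> * real l" for l :: nat
  have \<rho>: "0 < \<rho> l" "\<rho> l \<le> 1" "(\<rho> l)\<^sup>2 \<le> 16 * (\<epsilon>\<^sup>2 * (real L)\<^sup>2)" if "l \<in> {1..L}" for l
  proof -
    have l: "1 \<le> l" "real l \<le> real L" using that by auto
    then have le: "\<rho> l \<le> 4 * \<epsilon> * real L" unfolding \<rho>_def using e0 by (intro mult_left_mono) auto
    show "0 < \<rho> l" using l e0 by (simp add: \<rho>_def)
    show "\<rho> l \<le> 1" using le \<epsilon>(2) by linarith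
    have "(\<rho> l)\<^sup>2 \<le> (4 * \<epsilon> * real L)\<^sup>2" using le \<open>0 < \<rho> l\<close> by (intro power_mono) auto
    then show "(\<rho> l)\<^sup>2 \<le> 16 * (\<epsilon>\<^sup>2 * (real L)\<^sup>2)" by (simp add: power_mult_distrib)
  qed
  \<comment> \<open>1600 makes the Chebyshev bound \<open>1 / (k * (\<epsilon> / 2)\<^sup>2)\<close>
    at most \<open>1/400\<close>.\<close>
  define k where "k = nat \<lceil>1600 * q\<rceil>"
  define t where "t = nat \<lfloor>x * q / 200\<rfloor>"
  have k: "1600 * q \<le> real k" "real k \<le> 1600 * q + 1"
    using q16 nat_ceiling_bounds[of "1600 * q"] by (simp_all add: k_def)
  have xq: "100000000 * q \<le> x * q" using x q16 by (intro mult_right_mono) auto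
  have xq': "x * q \<le> real n * q" using xn q16 by (intro mult_right_mono) auto
  have t: "real t \<le> x * q / 200" "x * q / 200 - 1 \<le> real t"
    using q16 x nat_floor_bounds[of "x * q / 200"] by (simp_all add: t_def)
  have k1: "1 \<le> k" using k(1) q16 by linarith
  have kt: "k \<le> t" using k t xq q16 by linarith
  have kn: "real k \<le> real n / \<epsilon>\<^sup>2" and tn': "real t \<le> real n / \<epsilon>\<^sup>2"
  proof -
    have "real k \<le> real n * q" using k xq xq' q16 by linarith
    then show "real k \<le> real n / \<epsilon>\<^sup>2" by (simp add: q_def)
    have "real t \<le> real n * q" using t xq xq' q16 by linarith
    then show "real t \<le> real n / \<epsilon>\<^sup>2" by (simp add: q_def)
  qed
  have \<rho>k: "(\<rho> l)\<^sup>2 * real k \<le> real n / 10" if "l \<in> {1..L}" for l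
  proof -
    have "(\<rho> l)\<^sup>2 * real k \<le> 16 * (\<epsilon>\<^sup>2 * (real L)\<^sup>2) * (1600 * q + 1)"
      using \<rho>[OF that] k by (intro mult_mono) auto
    also have "\<dots> = (25600 * (\<epsilon>\<^sup>2 * q) + 16 * \<epsilon>\<^sup>2) * (real L)\<^sup>2" by (simp add: algebra_simps)
    also have "\<dots> \<le> (x / 10) * (real L)\<^sup>2"
      using e2 x unfolding eq by (intro mult_right_mono) auto
    finally show ?thesis by (simp add: nx)
  qed
  have \<rho>t: "(\<rho> l)\<^sup>2 * real t \<le> real n / 8" if "l \<in> {1..L}" for l
  proof -
    have "(\<rho> l)\<^sup>2 * real t \<le> 16 * (\<epsilon>\<^sup>2 * (real L)\<^sup>2) * (x * q / 200)"
      using \<rho>[OF that] t by (intro mult_mono) auto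
    also have "\<dots> = 16 * (\<epsilon>\<^sup>2 * q) * (x * (real L)\<^sup>2) / 200" by (simp add: algebra_simps)
    finally show ?thesis unfolding eq nx[symmetric] by simp
  qed
  let ?T = "tuples k (cube n)" and ?Y = "nonzero_cube n" and ?L = "{1..L}"
  have finT: "finite ?T" "?T \<noteq> {}" by (simp_all add: finite_tuples finite_X tuples_nonempty X_ne del: PiE_eq_empty_iff)
  have neL: "?L \<noteq> {}" using L1 by auto
  have tn: "0 \<le> tilt (\<rho> l) k S y" if "l \<in> ?L" for l S y using tilt_nonneg[of "\<rho> l" k S y] \<rho>[OF that] by simp
  \<comment> \<open>Mixing the levels in the weight yields common coins for all of them.
    Disjointness compares sets belonging to the same message and the same coins.\<close>
  define w where "w S y = mean ?L (\<lambda>l. tilt (\<rho> l) k S y)" for S y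
  have w0: "0 \<le> w S y" for S y unfolding w_def using tn by (intro mean_nonneg)
  have w1: "mean ?T (\<lambda>S. mean ?Y (w S)) = 1"
  proof -
    have "mean ?T (\<lambda>S. mean ?Y (w S)) = mean ?L (\<lambda>l. mean ?T (\<lambda>S. mean ?Y (tilt (\<rho> l) k S)))"
      unfolding w_def by (simp only: mean_swap[of ?Y ?L] mean_swap[of ?T ?L])
    then show ?thesis using neL by (simp add: mean_mean_tilt mean_const)
  qed
  obtain r where r: "r \<in> space M" and fail: "mean ?T (\<lambda>S. mean ?Y (\<lambda>y. w S y *
      of_bool (\<not> \<bar>B r (A r (empirical k S)) (return_pmf y) - sample_mean k S y\<bar> \<le> \<epsilon>))) \<le> \<delta> * 1"
    using failing_coins[OF est k1 w0 w1] by blast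
  define F where "F S y = (of_bool (\<not> \<bar>B r (A r (empirical k S)) (return_pmf y) - sample_mean k S y\<bar> \<le> \<epsilon>) :: real)" for S y
  \<comment> \<open>The levels are \<open>4 * \<epsilon>\<close> apart and the intervals only
    \<open>3 * \<epsilon>\<close> wide.\<close>
  define \<Phi> where "\<Phi> l m = {y \<in> ?Y. \<bar>B r m (return_pmf y) - \<rho> l\<bar> \<le> 3/2 * \<epsilon>}" for l m
  let ?\<Phi> = "\<lambda>l S. \<Phi> l (A r (empirical k S))"
  define b where "b l S = mean ?Y (\<lambda>y. tilt (\<rho> l) k S y * of_bool (y \<notin> ?\<Phi> l S))" for l S
  have b0: "0 \<le> b l S" if "l \<in> ?L" for l S unfolding b_def using tn[OF that] by (intro mean_nonneg) auto
  have bmean: "mean ?L (\<lambda>l. mean ?T (b l)) \<le> 1/2 + 1/400"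
  proof -
    have "mean ?T (b l) \<le> mean ?T (\<lambda>S. mean ?Y (\<lambda>y. F S y * tilt (\<rho> l) k S y)) + 1/400" if l: "l \<in> ?L" for l
    proof -
      have "mean ?T (b l) \<le> mean ?T (\<lambda>S. mean ?Y (\<lambda>y. F S y * tilt (\<rho> l) k S y +
          tilt (\<rho> l) k S y * of_bool (\<epsilon> / 2 < \<bar>sample_mean k S y - \<rho> l\<bar>)))"
        unfolding b_def
      proof (intro mean_mono)
        fix S y assume y: "y \<in> ?Y"
        have "\<bar>B r (A r (empirical k S)) (return_pmf y) - \<rho> l\<bar> \<le> 3/2 * \<epsilon>"
          if "\<bar>B r (A r (empirical k S)) (return_pmf y) - sample_mean k S y\<bar> \<le> \<epsilon>"
            "\<not> \<epsilon> / 2 < \<bar>sample_mean k S y - \<rho> l\<bar>"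
          using that by linarith
        then have "of_bool (y \<notin> ?\<Phi> l S) \<le> F S y + of_bool (\<epsilon> / 2 < \<bar>sample_mean k S y - \<rho> l\<bar>)"
          using y by (auto simp: \<Phi>_def F_def)
        then have "tilt (\<rho> l) k S y * of_bool (y \<notin> ?\<Phi> l S) \<le>
            tilt (\<rho> l) k S y * (F S y + of_bool (\<epsilon> / 2 < \<bar>sample_mean k S y - \<rho> l\<bar>))"
          by (intro mult_left_mono tn[OF l])
        then show "tilt (\<rho> l) k S y * of_bool (y \<notin> ?\<Phi> l S) \<le> F S y * tilt (\<rho> l) k S y +
            tilt (\<rho> l) k S y * of_bool (\<epsilon> / 2 < \<bar>sample_mean k S y - \<rho> l\<bar>)"
          by (simp only: distrib_left mult.commute)
      qed
      also have "\<dots> = mean ?T (\<lambda>S. mean ?Y (\<lambda>y. F S y * tilt (\<rho> l) k S y)) +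
          mean ?Y (\<lambda>y. mean ?T (\<lambda>S. tilt (\<rho> l) k S y * of_bool (\<epsilon> / 2 < \<bar>sample_mean k S y - \<rho> l\<bar>)))"
        by (simp only: mean_add mean_swap[of ?T ?Y "\<lambda>S y. tilt (\<rho> l) k S y * of_bool (\<epsilon> / 2 < \<bar>sample_mean k S y - \<rho> l\<bar>)"])
      also have "\<dots> \<le> mean ?T (\<lambda>S. mean ?Y (\<lambda>y. F S y * tilt (\<rho> l) k S y)) + mean ?Y (\<lambda>y. 1 / (real k * (\<epsilon> / 2)\<^sup>2))"
        using e0 \<rho>[OF l] k1 by (intro add_left_mono mean_mono tilted_sample_mean_deviation) auto
      also have "mean ?Y (\<lambda>y. 1 / (real k * (\<epsilon> / 2)\<^sup>2)) = 1 / (real k * (\<epsilon> / 2)\<^sup>2)"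
        by (rule mean_const[OF finite_Y Y_ne])
      also have "\<dots> \<le> 1 / 400"
      proof (rule divide_left_mono)
        have "\<epsilon>\<^sup>2 * (1600 * q) \<le> \<epsilon>\<^sup>2 * real k" using k by (intro mult_left_mono) auto
        moreover have "\<epsilon>\<^sup>2 * (1600 * q) = 1600 * (\<epsilon>\<^sup>2 * q)" by (simp only: mult_ac)
        ultimately have "1600 \<le> \<epsilon>\<^sup>2 * real k" unfolding eq by linarith
        then show "400 \<le> real k * (\<epsilon> / 2)\<^sup>2" by (simp add: power_divide mult_ac)
        then show "0 < real k * (\<epsilon> / 2)\<^sup>2 * 400" by linarith
      qed auto
      finally show ?thesis by simp
    qed
    then have "mean ?L (\<lambda>l. mean ?T (b l)) \<le> mean ?L (\<lambda>l. mean ?T (\<lambda>S. mean ?Y (\<lambda>y. F S y * tilt (\<rho> l) k S y)) + 1/400)"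
      by (rule mean_mono)
    also have "\<dots> = mean ?L (\<lambda>l. mean ?T (\<lambda>S. mean ?Y (\<lambda>y. F S y * tilt (\<rho> l) k S y))) + 1/400"
      using neL by (simp add: mean_add mean_const)
    also have "mean ?L (\<lambda>l. mean ?T (\<lambda>S. mean ?Y (\<lambda>y. F S y * tilt (\<rho> l) k S y))) =
        mean ?T (\<lambda>S. mean ?Y (\<lambda>y. mean ?L (\<lambda>l. F S y * tilt (\<rho> l) k S y)))"
      by (simp only: mean_swap[of ?L])
    also have "\<dots> = mean ?T (\<lambda>S. mean ?Y (\<lambda>y. w S y * F S y))"
      by (simp only: mean_cmult w_def mult.commute)
    also have "\<dots> \<le> 1/2" using fail \<delta> by (simp add: F_def)
    finally show ?thesis by simp
  qed
  \<comment> \<open>The threshold \<open>3/5\<close> was placed above \<open>1/2\<close> for this: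
    \<open>5/3 * (1/2 + 1/400) < 17/20\<close> leaves a constant fraction of levels and
    tuples.\<close>
  have light: "mean ?L (\<lambda>l. mean ?T (\<lambda>S. of_bool (3/5 < b l S))) \<le> 17/20"
  proof -
    have "mean ?L (\<lambda>l. mean ?T (\<lambda>S. of_bool (3/5 < b l S))) \<le> mean ?L (\<lambda>l. 5/3 * mean ?T (b l))"
    proof (rule mean_mono)
      fix l assume "l \<in> ?L"
      then have "mean ?T (\<lambda>S. of_bool (3/5 < b l S)) \<le> mean ?T (b l) / (3/5)"
        by (intro mean_markov b0) auto
      then show "mean ?T (\<lambda>S. of_bool (3/5 < b l S)) \<le> 5/3 * mean ?T (b l)" by simp
    qed
    then show ?thesis using bmean unfolding mean_cmult by linarith
  qed
  have sizes: "mean ?L (\<lambda>l. of_bool (exp (- 30) * real (card ?Y) < real (card (?\<Phi> l S)))) \<le> 1/50" for S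
  proof -
    have disj: "?\<Phi> l S \<inter> ?\<Phi> l' S = {}" if "l \<noteq> l'" for l l'
    proof -
      have "l = l'" if "y \<in> ?\<Phi> l S" "y \<in> ?\<Phi> l' S" for y
      proof -
        have "\<bar>4 * \<epsilon> * real l - 4 * \<epsilon> * real l'\<bar> \<le> 3 * \<epsilon>"
          using that unfolding \<Phi>_def \<rho>_def mem_Collect_eq by linarith
        then have "4 * \<epsilon> * \<bar>real l - real l'\<bar> \<le> 3 * \<epsilon>"
          using e0 by (simp add: right_diff_distrib[symmetric] abs_mult)
        then have le: "\<bar>real l - real l'\<bar> \<le> 3/4" using e0 by simp
        have "real l < real (Suc l')" "real l' < real (Suc l)"
          using abs_le_D1[OF le] abs_le_D2[OF le] by simp_all
        then show ?thesis unfolding of_nat_less_iff by simp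
      qed
      then show ?thesis using \<open>l \<noteq> l'\<close> by blast
    qed
    have sub: "?\<Phi> l S \<subseteq> ?Y" for l by (auto simp: \<Phi>_def)
    have "(\<Sum>l\<in>?L. card (?\<Phi> l S)) = card (\<Union>l\<in>?L. ?\<Phi> l S)"
      using disj finite_subset[OF sub finite_Y] by (intro card_UN_disjoint[symmetric]) auto
    also have "\<dots> \<le> card ?Y" using sub finite_Y by (intro card_mono) auto
    finally have "(\<Sum>l\<in>?L. card (?\<Phi> l S)) \<le> card ?Y" .
    then have "real (\<Sum>l\<in>?L. card (?\<Phi> l S)) \<le> real (card ?Y)" by (simp only: of_nat_le_iff)
    then have m: "mean ?L (\<lambda>l. real (card (?\<Phi> l S))) \<le> real (card ?Y) / real L"
      unfolding mean_def by (simp add: divide_right_mono)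
    have "mean ?L (\<lambda>l. of_bool (exp (- 30) * real (card ?Y) < real (card (?\<Phi> l S)))) \<le>
        mean ?L (\<lambda>l. real (card (?\<Phi> l S))) / (exp (- 30) * real (card ?Y))"
      using card_Y_pos by (intro mean_markov) auto
    also have "\<dots> \<le> real (card ?Y) / real L / (exp (- 30) * real (card ?Y))"
      using m by (intro divide_right_mono) auto
    also have "\<dots> = exp 30 / real L" using card_Y_pos by (simp add: exp_minus field_simps)
    also have "\<dots> \<le> 1/50" using L L1 by (simp add: divide_le_eq)
    finally show ?thesis .
  qed
  define Q where "Q l S \<longleftrightarrow> real (card (?\<Phi> l S)) \<le> exp (- 30) * real (card ?Y) \<and> b l S \<le> 3/5" for l S
  have "1 = mean ?L (\<lambda>l. mean ?T (\<lambda>S. 1))" using finT neL by (simp add: mean_const)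
  also have "\<dots> \<le> mean ?L (\<lambda>l. mean ?T (\<lambda>S. of_bool (Q l S) + (of_bool (3/5 < b l S) +
      of_bool (exp (- 30) * real (card ?Y) < real (card (?\<Phi> l S))))))"
    by (intro mean_mono) (auto simp: Q_def of_bool_def not_less)
  also have "\<dots> = mean ?L (\<lambda>l. mean ?T (\<lambda>S. of_bool (Q l S))) + (mean ?L (\<lambda>l. mean ?T (\<lambda>S. of_bool (3/5 < b l S))) +
      mean ?T (\<lambda>S. mean ?L (\<lambda>l. of_bool (exp (- 30) * real (card ?Y) < real (card (?\<Phi> l S))))))"
    by (simp only: mean_add mean_swap[of ?L ?T "\<lambda>l S. of_bool (exp (- 30) * real (card ?Y) < real (card (?\<Phi> l S)))"])
  also have "\<dots> \<le> mean ?L (\<lambda>l. mean ?T (\<lambda>S. of_bool (Q l S))) + (17/20 + mean ?T (\<lambda>S. 1/50))"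
    by (intro add_left_mono add_mono light mean_mono sizes)
  also have "mean ?T (\<lambda>S. 1/50) = 1/50" using finT by (rule mean_const)
  finally have Qm: "13/100 \<le> mean ?L (\<lambda>l. mean ?T (\<lambda>S. of_bool (Q l S)))" by simp
  have "\<exists>l\<in>?L. 1/10 \<le> mean ?T (\<lambda>S. of_bool (Q l S))"
  proof (rule ccontr)
    assume *: "\<not> ?thesis"
    have "mean ?L (\<lambda>l. mean ?T (\<lambda>S. of_bool (Q l S))) \<le> mean ?L (\<lambda>l. 1/10)"
    proof (rule mean_mono)
      fix l assume "l \<in> ?L"
      then show "mean ?T (\<lambda>S. of_bool (Q l S)) \<le> 1/10" using * by (meson less_imp_le not_le)
    qed
    then show False using Qm neL by (simp add: mean_const)
  qed
  then obtain l where l: "l \<in> ?L" and lQ: "1/10 \<le> mean ?T (\<lambda>S. of_bool (Q l S))" by blast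
  have "real t * (30 - 24) \<le> real C + 4 * real k + 6"
    using lQ e4 unfolding Q_def b_def
    by (intro counting_message_length[OF n(1) \<epsilon>(1) _ \<rho>(1,2)[OF l] k1 \<rho>k[OF l] kn kt \<rho>t[OF l] tn' r len, of "\<Phi> l"])
      (auto simp: \<Phi>_def)
  then have "6 * real t \<le> real C + 4 * real k + 6" by simp
  then have "x * q \<le> 100 * real C" using t k xq q16 by linarith
  then have "x * q * (real L)\<^sup>2 \<le> 100 * real C * (real L)\<^sup>2" by (intro mult_right_mono) auto
  moreover have "real n / \<epsilon>\<^sup>2 = x * q * (real L)\<^sup>2" by (simp add: nx q_def)
  ultimately show ?thesis by (simp only: mult_ac)
qed

text \<open>On point masses the target is 1 or -1, so an estimate within
  \<open>\<epsilon> < 1/3\<close> has the right sign. The sign of Bob's output then correlates with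
  the inner product by at least \<open>1 - 2 * \<delta>\<close>.\<close>

lemma guessing_advantage_square_le:
  assumes \<epsilon>: "\<epsilon> < 1/3" and \<delta>: "\<delta> < 1/2"
    and est: "one_way_estimates n (ip_sign n) \<epsilon> \<delta> M A B" and len: "message_length_le n M A C"
  shows "(1 - 2 * \<delta>)\<^sup>2 \<le> 2 ^ (C + 1) / real (2 ^ n - 1)"
proof -
  let ?X = "cube n" and ?Y = "nonzero_cube n"
  have bm: "bilinear_mean (ip_sign n) (return_pmf x) (return_pmf y) = ip_sign n x y" for x y
    by (simp add: bilinear_mean_def)
  obtain r where r: "r \<in> space M" and fail: "mean ?X (\<lambda>x. mean ?Y (\<lambda>y.
      of_bool (\<not> \<bar>B r (A r (return_pmf x)) (return_pmf y) - ip_sign n x y\<bar> \<le> \<epsilon>))) \<le> \<delta>"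
    using fixed_coins_mean[OF est finite_X finite_Y nonzero_subset_cube, of "\<lambda>_ _. 1" return_pmf]
      return_in_cube_pmfs by (auto simp: bm mean_const finite_X X_ne finite_Y Y_ne)
  define h where "h m y = (if 0 \<le> B r m (return_pmf y) then 1 else - 1 :: real)" for m y
  have "1 - 2 * of_bool (\<not> \<bar>B r (A r (return_pmf x)) (return_pmf y) - ip_sign n x y\<bar> \<le> \<epsilon>)
      \<le> ip_sign n x y * h (A r (return_pmf x)) y" for x y
    using \<epsilon> sign_cases[of x y] by (auto simp: h_def)
  then have "mean ?X (\<lambda>x. mean ?Y (\<lambda>y. 1 - 2 * of_bool (\<not> \<bar>B r (A r (return_pmf x)) (return_pmf y) - ip_sign n x y\<bar> \<le> \<epsilon>)))
      \<le> mean ?X (\<lambda>x. mean ?Y (\<lambda>y. ip_sign n x y * h (A r (return_pmf x)) y))"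
    by (intro mean_mono)
  then have "1 - 2 * \<delta> \<le> mean ?X (\<lambda>x. mean ?Y (\<lambda>y. ip_sign n x y * h (A r (return_pmf x)) y))"
    using fail by (simp only: mean_diff mean_cmult mean_const[OF finite_X X_ne] mean_const[OF finite_Y Y_ne])
  then have "(1 - 2 * \<delta>)\<^sup>2 \<le> (mean ?X (\<lambda>x. mean ?Y (\<lambda>y. ip_sign n x y * h (A r (return_pmf x)) y)))\<^sup>2"
    using \<delta> by (intro power_mono) auto
  also have "\<dots> \<le> real (card {m :: message. length m \<le> C}) / real (card ?Y)"
  proof (rule correlation_bound)
    show "finite {m :: message. length m \<le> C}" by (rule card_messages_le)
    show "A r (return_pmf x) \<in> {m. length m \<le> C}" if "x \<in> ?X" for x
      using len r return_in_cube_pmfs[OF that] by (simp add: message_length_le_def)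
    show "(h m y)\<^sup>2 \<le> 1" for m y by (simp add: h_def)
  qed
  also have "\<dots> \<le> 2 ^ (C + 1) / real (card ?Y)"
    by (intro divide_right_mono card_messages_le) auto
  finally show ?thesis by (simp add: card_nonzero_cube)
qed

text \<open>Without a message Bob's answer at a fixed \<open>y\<close> ignores \<open>x\<close>,
  while the signs over \<open>x\<close> are balanced. This excludes \<open>C = 0\<close>, where a
  bound by a constant could not be turned into a multiple of \<open>C\<close>.\<close>

lemma message_nonempty:
  assumes \<epsilon>: "\<epsilon> < 1/3" and \<delta>: "\<delta> < 1/2"
    and est: "one_way_estimates n (ip_sign n) \<epsilon> \<delta> M A B" and len: "message_length_le n M A C"
  shows "1 \<le> C"
proof (rule ccontr)
  assume "\<not> 1 \<le> C"
  then have "C = 0" by simp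
  then have nil: "A r p = []" if "r \<in> space M" "p \<in> cube_pmfs n" for r p
    using len that by (auto simp: message_length_le_def)
  let ?X = "cube n"
  obtain y where y: "y \<in> nonzero_cube n" using Y_ne by auto
  have bm: "bilinear_mean (ip_sign n) (return_pmf x) (return_pmf y) = ip_sign n x y" for x y
    by (simp add: bilinear_mean_def)
  have ycube: "{y} \<subseteq> ?X" using y nonzero_subset_cube by auto
  obtain r where r: "r \<in> space M" and fail: "mean ?X (\<lambda>x. mean {y} (\<lambda>y.
      of_bool (\<not> \<bar>B r (A r (return_pmf x)) (return_pmf y) - ip_sign n x y\<bar> \<le> \<epsilon>))) \<le> \<delta>"
    using fixed_coins_mean[OF est finite_X _ ycube, of "\<lambda>_ _. 1" return_pmf]
      return_in_cube_pmfs by (auto simp: bm mean_const finite_X X_ne)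
  define s where "s = (if 0 \<le> B r [] (return_pmf y) then 1 else - 1 :: real)"
  have "1 - 2 * of_bool (\<not> \<bar>B r (A r (return_pmf x)) (return_pmf y) - ip_sign n x y\<bar> \<le> \<epsilon>) \<le> s * ip_sign n x y"
    if "x \<in> ?X" for x
    using \<epsilon> sign_cases[of x y] nil[OF r return_in_cube_pmfs[OF that]] by (auto simp: s_def)
  then have "mean ?X (\<lambda>x. 1 - 2 * of_bool (\<not> \<bar>B r (A r (return_pmf x)) (return_pmf y) - ip_sign n x y\<bar> \<le> \<epsilon>))
      \<le> mean ?X (\<lambda>x. s * ip_sign n x y)"
    by (intro mean_mono)
  also have "\<dots> = 0" using mean_sign[OF y] by (simp add: mean_cmult)
  finally have "1 \<le> 2 * mean ?X (\<lambda>x. of_bool (\<not> \<bar>B r (A r (return_pmf x)) (return_pmf y) - ip_sign n x y\<bar> \<le> \<epsilon>))"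
    by (simp only: mean_diff mean_cmult mean_const[OF finite_X X_ne])
  also have "mean ?X (\<lambda>x. of_bool (\<not> \<bar>B r (A r (return_pmf x)) (return_pmf y) - ip_sign n x y\<bar> \<le> \<epsilon>)) \<le> \<delta>"
    using fail by (simp only: mean_singleton)
  finally show False using \<delta> by simp
qed

end

text \<open>The argument is the reciprocal of \<open>u = 1 - (1 - 2 * \<delta>)\<^sup>2\<close>,
  which is at least \<open>2 * \<delta>\<close>. That settles small \<open>\<delta>\<close>; near
  \<open>1/2\<close>, \<open>ln (1 / u) \<le> 1 / u - 1\<close> exhibits the quadratic
  vanishing.\<close>

lemma log2_chernoff_le:
  assumes "0 < \<delta>" "\<delta> < 1/2"
  shows "0 \<le> log 2 (1 / (4 * \<delta> * (1 - \<delta>)))"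
    and "log 2 (1 / (4 * \<delta> * (1 - \<delta>))) \<le> 2 * ln (1 / \<delta>)"
    and "log 2 (1 / (4 * \<delta> * (1 - \<delta>))) \<le> (1 - 2 * \<delta>)\<^sup>2 / \<delta>"
proof -
  define u where "u = 4 * \<delta> * (1 - \<delta>)"
  have u1: "u = 1 - (1 - 2 * \<delta>)\<^sup>2" by (simp add: u_def power2_eq_square algebra_simps)
  have "2 * \<delta> * 1 \<le> 2 * \<delta> * (2 * (1 - \<delta>))" using assms by (intro mult_left_mono) auto
  then have u2: "2 * \<delta> \<le> u" by (simp add: u_def mult_ac)
  have u0: "0 < u" using u2 assms by linarith
  have "u \<le> 1" using u1 by simp
  then have ln0: "0 \<le> ln (1 / u)" using u0 by simp
  have log: "log 2 (1 / u) \<le> 2 * ln (1 / u)" and log0: "0 \<le> log 2 (1 / u)"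
  proof -
    have "1/2 \<le> ln (2::real)" using ln2_ge_two_thirds by simp
    then have "ln (1 / u) / ln 2 \<le> ln (1 / u) / (1/2)"
      using ln0 by (intro divide_left_mono) auto
    then show "log 2 (1 / u) \<le> 2 * ln (1 / u)" by (simp add: log_def)
    show "0 \<le> log 2 (1 / u)" using ln0 by (simp add: log_def)
  qed
  show "0 \<le> log 2 (1 / (4 * \<delta> * (1 - \<delta>)))" using log0 by (simp add: u_def)
  have "1 / u \<le> 1 / \<delta>" using u2 u0 assms by (intro divide_left_mono) auto
  then have "ln (1 / u) \<le> ln (1 / \<delta>)" using u0 assms by (intro ln_mono) auto
  then show "log 2 (1 / (4 * \<delta> * (1 - \<delta>))) \<le> 2 * ln (1 / \<delta>)"
    using log by (simp add: u_def)
  have "ln (1 / u) \<le> 1 / u - 1" using u0 by (intro ln_le_minus_one) auto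
  also have "\<dots> = (1 - 2 * \<delta>)\<^sup>2 / u" using u0 u1 by (simp add: field_simps)
  also have "\<dots> \<le> (1 - 2 * \<delta>)\<^sup>2 / (2 * \<delta>)"
    using u2 u0 assms by (intro divide_left_mono) auto
  finally have "2 * ln (1 / u) \<le> (1 - 2 * \<delta>)\<^sup>2 / \<delta>" by simp
  then show "log 2 (1 / (4 * \<delta> * (1 - \<delta>))) \<le> (1 - 2 * \<delta>)\<^sup>2 / \<delta>"
    using log by (simp add: u_def)
qed

lemma square_le_two_power: "10 \<le> n \<Longrightarrow> n\<^sup>2 \<le> (2::nat) ^ n"
proof (induction n rule: dec_induct)
  case (step n)
  have "(Suc n)\<^sup>2 \<le> 2 * n\<^sup>2"
  proof -
    have "10 * n \<le> n * n" using step by (intro mult_right_mono) auto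
    moreover have "Suc n * Suc n = n * n + 2 * n + 1" by simp
    ultimately show ?thesis unfolding power2_eq_square using step(1) by linarith
  qed
  then show ?case using step by simp
qed (simp add: power2_eq_square)

text \<open>For \<open>C\<close> at least \<open>n / 2\<close> there is nothing to do. Otherwise
  \<open>2 ^ C * n \<le> 2 ^ n\<close>, so the discrepancy bound makes the left side at most 4, and
  \<open>1 \<le> C\<close> finishes.\<close>

lemma (in inner_product_cube) guessing_advantage_le_message_length:
  assumes n: "10 \<le> n" and \<epsilon>: "\<epsilon> < 1/3" and \<delta>: "0 < \<delta>" "\<delta> < 1/2"
    and est: "one_way_estimates n (ip_sign n) \<epsilon> \<delta> M A B" and len: "message_length_le n M A C"
  shows "real n * (1 - 2 * \<delta>)\<^sup>2 \<le> 4 * real C"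
proof (cases "n \<le> 2 * C")
  case True
  have "(1 - 2 * \<delta>)\<^sup>2 \<le> 1" using \<delta> by (intro power_le_one) auto
  then have "real n * (1 - 2 * \<delta>)\<^sup>2 \<le> real n * 1" by (intro mult_left_mono) auto
  also have "\<dots> \<le> 4 * real C" using True by simp
  finally show ?thesis .
next
  case False
  have "(1::nat) \<le> C" by (rule message_nonempty[OF \<epsilon> \<delta>(2) est len])
  have "(2::nat) ^ 1 \<le> 2 ^ n" using n by (intro power_increasing) auto
  then have "2 ^ n \<le> 2 * ((2::nat) ^ n - 1)" by simp
  then have half: "2 ^ n \<le> 2 * real (2 ^ n - 1)"
    by (metis of_nat_le_iff of_nat_mult of_nat_numeral of_nat_power)
  have "(2 ^ C * n)\<^sup>2 \<le> ((2::nat) ^ n)\<^sup>2"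
  proof -
    have "(2 ^ C * n)\<^sup>2 = (2::nat) ^ (2 * C) * n\<^sup>2" by (simp add: power_mult_distrib power_mult[symmetric] mult.commute)
    also have "\<dots> \<le> 2 ^ n * 2 ^ n"
      using False square_le_two_power[OF n] by (intro mult_mono power_increasing) auto
    finally show ?thesis by (simp add: power2_eq_square)
  qed
  then have "2 ^ C * n \<le> (2::nat) ^ n" by (rule power2_le_imp_le) simp
  then have "real (2 ^ C * n) \<le> real (2 ^ n)" by (simp only: of_nat_le_iff)
  then have prod: "2 ^ C * real n \<le> 2 ^ n" by simp
  have pos: "0 < real (2 ^ n - 1)" 
  proof -
    have "(0::real) < 2 ^ n" by simp
    then show ?thesis using half by linarith
  qed
  have "(1 - 2 * \<delta>)\<^sup>2 \<le> 2 ^ (C + 1) / real (2 ^ n - 1)"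
    by (rule guessing_advantage_square_le[OF \<epsilon> \<delta>(2) est len])
  then have "real n * (1 - 2 * \<delta>)\<^sup>2 \<le> real n * (2 ^ (C + 1) / real (2 ^ n - 1))"
    by (intro mult_left_mono) auto
  also have "\<dots> \<le> 4"
    using prod half pos by (simp add: divide_le_eq mult_ac)
  also have "\<dots> \<le> 4 * real C" using \<open>1 \<le> C\<close> by simp
  finally show ?thesis .
qed

theorem theorem6p1:
  "\<exists>c\<^sub>0>0. \<exists>K>0. \<forall>(n::nat) (\<epsilon>::real) (\<delta>::real).
     2 powr (- (c\<^sub>0 * real n)) < \<epsilon> \<and> \<epsilon> < 1/3 \<and>
     2 powr (- real n) < \<delta> \<and> \<delta> < 1/2 \<longrightarrow>
     (\<forall>(M :: coins measure) (A :: alice) (B :: bob) (C :: nat).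
        one_way_estimates n (ip_sign n) \<epsilon> \<delta> M A B \<and> message_length_le n M A C \<longrightarrow>
        real C \<ge> K * (real n * log 2 (1 / (4 * \<delta> * (1 - \<delta>))) / \<epsilon>\<^sup>2))"
proof -
  define L where "L = nat \<lceil>50 * exp (30 :: real)\<rceil>"
  have L: "50 * exp 30 \<le> real L" unfolding L_def by (rule real_nat_ceiling_ge)
  have "1 * 1 \<le> 50 * exp (30 :: real)" by (intro mult_mono) auto
  then have L1: "1 \<le> real L" using L by linarith
  define n0 where "n0 = 10 ^ 9 + 10 ^ 8 * L\<^sup>2"
  \<comment> \<open>With this choice any \<open>n \<le> n0\<close> would give
    \<open>\<epsilon> > 1/2\<close>, so the lower bound on \<open>\<epsilon>\<close> itself forces
    \<open>n\<close> to be large.\<close>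
  define c0 where "c0 = 1 / real n0"
  define d0 where "d0 = exp (- (10 ^ 6) :: real)"
  \<comment> \<open>The reciprocals of the constants obtained in the three cases below.\<close>
  define K where "K = min (1 / (8 * 10 ^ 6)) (min (1 / (2 * 10 ^ 8 * (real L)\<^sup>2)) (d0 / (64 * (real L)\<^sup>2)))"
  have n0: "100 \<le> real n0" by (simp add: n0_def)
  have c0: "0 < c0" "c0 \<le> 1/100" using n0 by (auto simp: c0_def divide_le_eq)
  have d0: "0 < d0" by (simp add: d0_def)
  have LL: "0 < (real L)\<^sup>2" using L1 by simp
  have K0: "0 < K" using LL d0 by (simp add: K_def)
  have "K * (real n * log 2 (1 / (4 * \<delta> * (1 - \<delta>))) / \<epsilon>\<^sup>2) \<le> real C"
    if e1: "2 powr (- (c0 * real n)) < \<epsilon>" and e2: "\<epsilon> < 1/3" and d1: "2 powr (- real n) < \<delta>" and d2: "\<delta> < 1/2"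
      and est: "one_way_estimates n (ip_sign n) \<epsilon> \<delta> M A B" and len: "message_length_le n M A C"
    for n :: nat and \<epsilon> \<delta> :: real and M A B C
  proof -
    have n: "n0 \<le> n"
    proof (rule ccontr)
      assume "\<not> n0 \<le> n"
      then have "c0 * real n \<le> 1" using n0 by (simp add: c0_def divide_le_eq)
      then have "2 powr (- 1) \<le> 2 powr (- (c0 * real n))" by (intro powr_mono) auto
      moreover have "2 powr (- 1) = (1/2 :: real)" by (simp add: powr_minus_divide)
      ultimately show False using e1 e2 by linarith
    qed
    have n9: "10 ^ 9 \<le> n" and nL: "10 ^ 8 * L\<^sup>2 \<le> n" using n unfolding n0_def by auto
    interpret inner_product_cube n by unfold_locales (use n9 in simp)
    have "c0 * real n \<le> 1/100 * real n" using c0 by (intro mult_right_mono) auto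
    then have "2 powr (- (real n / 100)) \<le> 2 powr (- (c0 * real n))" by (intro powr_mono) auto
    then have e1': "2 powr (- (real n / 100)) < \<epsilon>" using e1 by linarith
    have e0: "0 < \<epsilon>" using e1 by (meson powr_ge_zero le_less_trans)
    have dpos: "0 < \<delta>" using d1 by (meson powr_ge_zero le_less_trans)
    define g where "g = log 2 (1 / (4 * \<delta> * (1 - \<delta>)))"
    have g: "0 \<le> g" "g \<le> 2 * ln (1 / \<delta>)" "g \<le> (1 - 2 * \<delta>)\<^sup>2 / \<delta>"
      unfolding g_def using log2_chernoff_le[OF dpos d2] by auto
    have T0: "0 \<le> real n * g / \<epsilon>\<^sup>2" using g by simp
    have reduce: "K * (real n * g / \<epsilon>\<^sup>2) \<le> real C"
      if "0 < c" "real n * g / \<epsilon>\<^sup>2 \<le> c * real C" "K \<le> 1 / c" for c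
    proof -
      have "K * (real n * g / \<epsilon>\<^sup>2) \<le> 1 / c * (c * real C)"
        using that K0 T0 by (intro mult_mono) auto
      then show ?thesis using that by simp
    qed
    \<comment> \<open>In the last case \<open>\<delta> \<ge> d0\<close> and
      \<open>1 / \<epsilon>\<^sup>2 \<le> 16 * L\<^sup>2\<close>, so both enter only as constants;
      what survives is the decay of the logarithm as \<open>\<delta>\<close> tends to
      \<open>1/2\<close>.\<close>
    consider "10 ^ 6 \<le> ln (1 / \<delta>)" | "ln (1 / \<delta>) < 10 ^ 6" "4 * \<epsilon> * real L \<le> 1" | "ln (1 / \<delta>) < 10 ^ 6" "1 < 4 * \<epsilon> * real L"
      by linarith
    then have "K * (real n * g / \<epsilon>\<^sup>2) \<le> real C"
    proof cases
      case 1
      have "real n * g / \<epsilon>\<^sup>2 \<le> real n * (2 * ln (1 / \<delta>)) / \<epsilon>\<^sup>2"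
        using g by (intro divide_right_mono mult_left_mono) auto
      also have "\<dots> = 2 * (real n * ln (1 / \<delta>) / \<epsilon>\<^sup>2)" by simp
      also have "\<dots> \<le> 2 * (4 * 10 ^ 6 * real C)"
        by (intro mult_left_mono small_error_message_length[OF n9 e1' e2 d1 1 est len]) auto
      finally have "real n * g / \<epsilon>\<^sup>2 \<le> 8 * 10 ^ 6 * real C" by simp
      then show ?thesis by (intro reduce[of "8 * 10 ^ 6"]) (auto simp: K_def)
    next
      case 2
      have "real n * g / \<epsilon>\<^sup>2 \<le> real n * (2 * 10 ^ 6) / \<epsilon>\<^sup>2"
        using g 2 by (intro divide_right_mono mult_left_mono) auto
      also have "\<dots> = 2 * 10 ^ 6 * (real n / \<epsilon>\<^sup>2)" by simp
      also have "\<dots> \<le> 2 * 10 ^ 6 * (100 * (real L)\<^sup>2 * real C)"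
        using d2 by (intro mult_left_mono multi_level_message_length[OF n9 nL e1' 2(2) L _ est len]) auto
      finally have "real n * g / \<epsilon>\<^sup>2 \<le> 2 * 10 ^ 8 * (real L)\<^sup>2 * real C" by simp
      then show ?thesis using LL by (intro reduce[of "2 * 10 ^ 8 * (real L)\<^sup>2"]) (auto simp: K_def)
    next
      case 3
      have "- (10 ^ 6) \<le> ln \<delta>" using 3(1) dpos by (simp add: ln_div)
      then have "d0 \<le> exp (ln \<delta>)" unfolding d0_def by (simp only: exp_le_cancel_iff)
      then have dd: "d0 \<le> \<delta>" using dpos by simp
      have "1 / \<epsilon> \<le> 4 * real L" using 3(2) e0 by (simp add: divide_le_eq mult_ac)
      then have "(1 / \<epsilon>)\<^sup>2 \<le> (4 * real L)\<^sup>2" using e0 by (intro power_mono) auto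
      then have eL: "1 / \<epsilon>\<^sup>2 \<le> 16 * (real L)\<^sup>2" by (simp add: power_divide power_mult_distrib)
      have "g \<le> (1 - 2 * \<delta>)\<^sup>2 / d0"
        using g(3) dd dpos d0 by (intro order_trans[OF g(3)] divide_left_mono) auto
      then have "real n * g \<le> real n * ((1 - 2 * \<delta>)\<^sup>2 / d0)" by (intro mult_left_mono) auto
      also have "\<dots> = real n * (1 - 2 * \<delta>)\<^sup>2 / d0" by simp
      also have "\<dots> \<le> 4 * real C / d0"
        using d0 n9 by (intro divide_right_mono guessing_advantage_le_message_length[OF _ e2 dpos d2 est len]) auto
      finally have "(real n * g) * (1 / \<epsilon>\<^sup>2) \<le> (4 * real C / d0) * (16 * (real L)\<^sup>2)"
        using eL d0 by (intro mult_mono) auto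
      then have "real n * g / \<epsilon>\<^sup>2 \<le> 64 * (real L)\<^sup>2 / d0 * real C" by (simp add: mult_ac)
      then show ?thesis using LL d0 by (intro reduce[of "64 * (real L)\<^sup>2 / d0"]) (auto simp: K_def)
    qed
    then show ?thesis by (simp only: g_def)
  qed
  then show ?thesis using c0(1) K0 by blast
qed

end
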